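(* Let $G=[3^k,\infty^l]$ with $k,l\ge0$, $k+l=n-1$, realized by the basic system $b_0,\dots,b_{n-1}$ with $b_i\cdot b_i=1$ for all $i$, $b_{j-1}\cdot b_j=-1/2$ for $1\le j\le k$, $b_{j-1}\cdot b_j=-1$ for $k<j\le n-1$, and $b_i\cdot b_j=0$ for $|i-j|\ge2$. Then for every prime $p\ge3$, the group $G^p=[3^k,\infty^l]^p$ is a string C-group.
   Context: $[3^k,\infty^l]$ denotes the string Coxeter group with $k$ consecutive periods $3$ followed by $l$ periods $\infty$, represented on $\mathbb{R}^n$ by the reflections $r_i(x)=x-2(x\cdot b_i)b_i$. $G^p\le GL_n(\mathbb{Z}_p)$ is the group generated by the reductions mod $p$ of $r_0,\dots,r_{n-1}$ (still denoted $r_i$). $G^p$ is a string C-group if $\langle r_i:i\in I\rangle\cap\langle r_i:i\in J\rangle=\langle r_i:i\in I\cap J\rangle$ for all $I,J\subseteq\{0,\dots,n-1\}$. *)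

theory Defs
  imports
    "HOL-Analysis.Linear_Algebra"
    "HOL-Algebra.Generated_Groups"
    "Jordan_Normal_Form.Matrix"
    "Berlekamp_Zassenhaus.Finite_Field"
begin

text \<open>
  A symmetric bilinear form on the ambient real vector space is passed as a function \<open>form\<close>. It is
  unrelated to the Euclidean inner product: it may be degenerate or indefinite.  The formula is the
  reflection in \<open>a\<close> only for vectors normalised by \<open>form a a = 1\<close>.
\<close>

definition form_reflection :: "('v::real_vector \<Rightarrow> 'v \<Rightarrow> real) \<Rightarrow> 'v \<Rightarrow> 'v \<Rightarrow> 'v" where
  "form_reflection form a x = x - (2 * form x a) *\<^sub>R a"

text \<open>
  The matrix of \<open>r\<^sub>i\<close> in the basis \<open>b 0, \<dots>, b (n - 1)\<close>, acting on columns: column \<open>j\<close> consists of the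
  coordinates of \<open>r\<^sub>i (b j)\<close>.
\<close>

definition reflection_mat ::
    "('v::real_vector \<Rightarrow> 'v \<Rightarrow> real) \<Rightarrow> (nat \<Rightarrow> 'v) \<Rightarrow> nat \<Rightarrow> nat \<Rightarrow> real mat" where
  "reflection_mat form b n i =
     mat n n (\<lambda>(m, j). representation (b ` {..<n}) (form_reflection form (b i) (b j)) (b m))"

text \<open>
  Entrywise reduction modulo \<open>p = CARD('p)\<close>.  It is only meaningful for matrices with integer
  entries, on which the floor merely changes the type from \<open>real\<close> to \<open>int\<close>; the lemma
  \<open>reflection_mat_Ints\<close> below shows that the reflection matrices are of this kind as soon as all
  \<open>2 * form (b j) (b i)\<close> are integers.
\<close>

definition reduce_mat :: "real mat \<Rightarrow> 'p::prime_card mod_ring mat" where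
  "reduce_mat A = map_mat (\<lambda>x. of_int \<lfloor>x\<rfloor>) A"

definition GL_group :: "nat \<Rightarrow> 'a::semiring_1 mat monoid" where
  "GL_group n = units_of (ring_mat TYPE('a) n ())"

definition reduced_reflection ::
    "('v::real_vector \<Rightarrow> 'v \<Rightarrow> real) \<Rightarrow> (nat \<Rightarrow> 'v) \<Rightarrow> nat \<Rightarrow> nat \<Rightarrow> 'p::prime_card mod_ring mat" where
  "reduced_reflection form b n i = reduce_mat (reflection_mat form b n i)"

definition reduced_group ::
    "('v::real_vector \<Rightarrow> 'v \<Rightarrow> real) \<Rightarrow> (nat \<Rightarrow> 'v) \<Rightarrow> nat \<Rightarrow> 'p::prime_card mod_ring mat monoid" where
  "reduced_group form b n =
     (GL_group n)\<lparr>carrier := generate (GL_group n) (reduced_reflection form b n ` {..<n})\<rparr>"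

text \<open>
  The first five conditions say that \<open>G\<close> is a string group generated by involutions; the last one is
  the intersection property.
\<close>

definition string_C_group :: "('a, 'c) monoid_scheme \<Rightarrow> nat \<Rightarrow> (nat \<Rightarrow> 'a) \<Rightarrow> bool" where
  "string_C_group G n r \<longleftrightarrow>
     group G \<and>
     r ` {..<n} \<subseteq> carrier G \<and>
     generate G (r ` {..<n}) = carrier G \<and>
     (\<forall>i<n. r i \<noteq> \<one>\<^bsub>G\<^esub> \<and> r i \<otimes>\<^bsub>G\<^esub> r i = \<one>\<^bsub>G\<^esub>) \<and>
     (\<forall>i<n. \<forall>j<n. i + 2 \<le> j \<longrightarrow> r i \<otimes>\<^bsub>G\<^esub> r j = r j \<otimes>\<^bsub>G\<^esub> r i) \<and>
     (\<forall>I J. I \<subseteq> {..<n} \<longrightarrow> J \<subseteq> {..<n} \<longrightarrow>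
        generate G (r ` I) \<inter> generate G (r ` J) = generate G (r ` (I \<inter> J)))"

lemma reflection_mat_entry:
  assumes "inj_on b {..<n}" "independent (b ` {..<n})" "i < n" "j < n" "m < n"
  shows "reflection_mat form b n i $$ (m, j) =
    (if m = j then 1 else 0) - (if m = i then 2 * form (b j) (b i) else 0)"
proof -
  let ?B = "b ` {..<n}"
  have span: "b j \<in> span ?B" "b i \<in> span ?B"
    using assms by (auto intro: span_base)
  have basis: "representation ?B (b k) (b m) = (if m = k then 1 else 0)" if "k < n" for k
    using representation_basis[OF assms(2), of "b k"] that assms(1,5)
    by (auto dest: inj_onD)
  have "representation ?B (form_reflection form (b i) (b j)) (b m) =
      representation ?B (b j) (b m) - (2 * form (b j) (b i)) * representation ?B (b i) (b m)"
    using span assms(2)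
    by (simp add: form_reflection_def representation_diff representation_scale span_scale)
  then show ?thesis
    using assms by (auto simp: reflection_mat_def basis)
qed

lemma reflection_mat_Ints:
  assumes "inj_on b {..<n}" "independent (b ` {..<n})" "i < n" "j < n" "m < n"
    and "2 * form (b j) (b i) \<in> \<int>"
  shows "reflection_mat form b n i $$ (m, j) \<in> \<int>"
  using assms by (simp add: reflection_mat_entry)

end

theory Submission
  imports Defs
begin

text \<open>
  The intersection property follows from one statement about stabilizers: if an element of the group of an
  interval \<open>{a..<e}\<close> of generators moves every vector only in the directions \<open>b\<^sub>m\<close> with \<open>m > s\<close>,
  then it lies in the group of \<open>{s+1..<e}\<close>.  If all periods of the interval become \<open>3\<close> modulo \<open>p\<close>
  (in particular if \<open>p = 3\<close>), the braid relations give coset representatives as in the symmetric group.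
  Otherwise \<open>p \<ge> 5\<close> and the interval ends in a period \<open>\<infinity>\<close>.  Then \<open>b\<^sub>e\<^sub>-\<^sub>2 + b\<^sub>e\<^sub>-\<^sub>1\<close> is
  isotropic, and with the help of Siegel transformations the group of \<open>{s+1..<e}\<close> is seen to contain the
  reflections in all unit vectors of its subspace.  By the Cartan-Dieudonne theorem, an isometry moving
  vectors only inside this subspace is a product of such reflections and of at most one reflection in a
  vector of nonsquare length, and the latter is excluded by a sign character that replaces the
  spinor norm.
\<close>

section \<open>Groups of bijections generated by involutions\<close>

text \<open>All periods \<infinity> stand at the right end of the string. Hence generators are only
  ever cut off on the left: the remaining interval still ends at the same place. The stabilizer
  condition restricts the displacements \<open>h x - x\<close> instead of prescribing fixed vectors,
  because the reduced form may be degenerate and orthogonal complements then do not determine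
  subspaces. Degeneracy is also why radicals are followed throughout: the span of an interval can
  have a one-dimensional radical, but the basis vector just before the interval shows that no
  nonzero vector of the span is orthogonal to the whole space. The obstacle for p \<ge> 5 is that
  mirrors of unit vectors generate too small a group in general: a mirror of nonsquare length has to
  be detected inside a subspace by an invariant of the ambient space. The prime 3 stands apart for
  two reasons: there the product -1 has double -2 = 1, so a period \<infinity> turns into a period
  3, and several auxiliary vectors serve their purpose only when 3 is invertible.\<close>

inductive_set gen :: "('v \<Rightarrow> 'v) set \<Rightarrow> ('v \<Rightarrow> 'v) set" for S where
  gen_id: "id \<in> gen S"
| gen_step: "s \<in> S \<Longrightarrow> g \<in> gen S \<Longrightarrow> s \<circ> g \<in> gen S"

lemma gen_base: "s \<in> S \<Longrightarrow> s \<in> gen S"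
  using gen_step[OF _ gen_id] by force

lemma gen_comp: "g \<in> gen S \<Longrightarrow> h \<in> gen S \<Longrightarrow> g \<circ> h \<in> gen S"
  by (induction rule: gen.induct) (auto simp: comp_assoc gen_step)

lemma gen_subset:
  assumes "S \<subseteq> gen T" shows "gen S \<subseteq> gen T"
proof
  fix g assume "g \<in> gen S" then show "g \<in> gen T"
  proof induction
    case gen_id show ?case by (rule gen.gen_id)
  next
    case (gen_step s g)
    then show ?case using assms gen_comp by blast
  qed
qed

lemma gen_mono: "S \<subseteq> T \<Longrightarrow> gen S \<subseteq> gen T"
  by (intro gen_subset) (auto intro: gen_base)

lemma gen_inverse:
  assumes "\<And>s. s \<in> S \<Longrightarrow> s \<circ> s = id" "g \<in> gen S"
  obtains h where "h \<in> gen S" "g \<circ> h = id" "h \<circ> g = id"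
proof -
  from assms(2) have "\<exists>h\<in>gen S. g \<circ> h = id \<and> h \<circ> g = id"
  proof induction
    case gen_id show ?case by (rule bexI[of _ id]) (simp_all add: gen.gen_id)
  next
    case (gen_step s g)
    then obtain h where h: "h \<in> gen S" "g \<circ> h = id" "h \<circ> g = id" by blast
    have "(s \<circ> g) \<circ> (h \<circ> s) = s \<circ> (g \<circ> h) \<circ> s" "(h \<circ> s) \<circ> (s \<circ> g) = h \<circ> (s \<circ> s) \<circ> g"
      by (simp_all add: comp_assoc)
    then have "(s \<circ> g) \<circ> (h \<circ> s) = id" "(h \<circ> s) \<circ> (s \<circ> g) = id"
      using h assms(1)[OF gen_step(1)] by simp_all
    then show ?case using h(1) gen_step(1) by (blast intro: gen_comp gen_base)
  qed
  then show thesis using that by blast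
qed

lemma gen_commute:
  assumes "g \<in> gen S" "\<And>s. s \<in> S \<Longrightarrow> s \<circ> t = t \<circ> s"
  shows "g \<circ> t = t \<circ> g"
  using assms(1)
proof induction
  case (gen_step s g)
  have "s \<circ> g \<circ> t = s \<circ> (g \<circ> t)" by (simp add: comp_assoc)
  also have "\<dots> = (s \<circ> t) \<circ> g" by (simp only: gen_step.IH comp_assoc)
  also have "\<dots> = t \<circ> (s \<circ> g)" by (simp only: gen_step.hyps assms(2) comp_assoc)
  finally show ?case .
qed simp

section \<open>Reflections and isometries\<close>

text \<open>The span of the basis vectors indexed by \<open>A\<close>, a polynomial being read as
  its list of coordinates.\<close>

definition supp_in :: "nat set \<Rightarrow> 'a::zero poly set" where
  "supp_in A = {x. \<forall>m. m \<notin> A \<longrightarrow> coeff x m = 0}"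

lemma supp_in_mono: "A \<subseteq> A' \<Longrightarrow> supp_in A \<subseteq> supp_in A'"
  by (auto simp: supp_in_def)

lemma finite_supp_in:
  assumes "finite (UNIV :: 'a::zero set)" "finite A"
  shows "finite (supp_in A :: 'a poly set)"
proof -
  have "inj_on (\<lambda>x. restrict (coeff x) A) (supp_in A :: 'a poly set)"
  proof
    fix x y :: "'a poly"
    assume xy: "x \<in> supp_in A" "y \<in> supp_in A" "restrict (coeff x) A = restrict (coeff y) A"
    show "x = y"
    proof (rule poly_eqI)
      fix m show "coeff x m = coeff y m"
        using xy(1,2) fun_cong[OF xy(3), of m] by (cases "m \<in> A") (auto simp: supp_in_def)
    qed
  qed
  moreover have "(\<lambda>x. restrict (coeff x) A) ` (supp_in A :: 'a poly set) \<subseteq> (A \<rightarrow>\<^sub>E UNIV)" by auto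
  moreover have "finite (A \<rightarrow>\<^sub>E (UNIV :: 'a set))" by (intro finite_PiE assms)
  ultimately show ?thesis by (meson finite_imageD finite_subset)
qed

notation smult (infixr "\<cdot>" 75)

text \<open>Vectors are encoded as polynomials, the coefficient of degree \<open>m\<close> being the coordinate at the
  basis vector \<open>b\<^sub>m\<close>; so one type serves all dimensions.\<close>

locale bform =
  fixes B :: "'a::field poly \<Rightarrow> 'a poly \<Rightarrow> 'a"
  assumes add_left [simp]: "B (x + y) z = B x z + B y z"
    and smul_left [simp]: "B (c \<cdot> x) z = c * B x z"
    and sym: "B x y = B y x"
    and two [simp]: "(2::'a) \<noteq> 0"
begin

lemma add_right [simp]: "B x (y + z) = B x y + B x z"
  by (metis add_left sym)

lemma smul_right [simp]: "B x (c \<cdot> y) = c * B x y"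
  by (metis smul_left sym)

lemma minus_left [simp]: "B (- x) z = - B x z"
proof -
  have "- x = (-1) \<cdot> x" by simp
  then show ?thesis by (metis smul_left mult_minus1)
qed

lemma minus_right [simp]: "B x (- z) = - B x z"
  by (metis minus_left sym)

lemma diff_left [simp]: "B (x - y) z = B x z - B y z"
  using add_left[of x "- y" z] by simp

lemma diff_right [simp]: "B x (y - z) = B x y - B x z"
  by (metis diff_left sym)

lemma zero_left [simp]: "B 0 x = 0"
  using diff_left[of 0 0 x] by simp

lemma zero_right [simp]: "B x 0 = 0"
  by (metis zero_left sym)

lemma four [simp]: "(4::'a) \<noteq> 0"
proof -
  have "(4::'a) = 2 * 2" by simp
  then show ?thesis by (metis two mult_eq_0_iff)
qed

text \<open>Injectivity does not follow when the form is degenerate; where it is required, it comes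
  from \<open>h\<close> being a product of mirrors.\<close>

definition isom :: "('a poly \<Rightarrow> 'a poly) \<Rightarrow> bool" where
  "isom h \<longleftrightarrow> (\<forall>x y. h (x + y) = h x + h y) \<and> (\<forall>c x. h (c \<cdot> x) = c \<cdot> h x) \<and>
     (\<forall>x y. B (h x) (h y) = B x y)"

lemma isomD:
  assumes "isom h"
  shows "h (x + y) = h x + h y" "h (c \<cdot> x) = c \<cdot> h x" "B (h x) (h y) = B x y"
    "h (- x) = - h x" "h (x - y) = h x - h y" "h 0 = 0"
proof -
  show *: "h (x + y) = h x + h y" "h (c \<cdot> x) = c \<cdot> h x" "B (h x) (h y) = B x y" for x y c
    using assms by (auto simp: isom_def)
  have m: "- x = (-1) \<cdot> x" for x :: "'a poly" by simp
  show "h (- x) = - h x" for x using *(2)[of "-1" x] by (simp flip: m)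
  then show "h (x - y) = h x - h y" for x y using *(1)[of x "- y"] by simp
  then show "h 0 = 0" by (metis diff_self)
qed

lemma isom_id [simp]: "isom id" by (simp add: isom_def)

lemma isom_comp: "isom g \<Longrightarrow> isom h \<Longrightarrow> isom (g \<circ> h)"
  by (simp add: isom_def)

text \<open>For isotropic \<open>v\<close> the coefficient is \<open>0\<close>, and \<open>mirror v\<close> is the identity.\<close>

definition mirror :: "'a poly \<Rightarrow> 'a poly \<Rightarrow> 'a poly" where
  "mirror v x = x - (2 * B x v / B v v) \<cdot> v"

lemma isom_mirror [simp]: "isom (mirror v)"
proof (cases "B v v = 0")
  case True
  then show ?thesis by (simp add: isom_def mirror_def)
next
  case False
  have "B (mirror v x) (mirror v y) = B x y" for x y
    using False by (simp add: mirror_def sym[of v y] field_simps)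
  moreover have "mirror v (x + y) = mirror v x + mirror v y" "mirror v (c \<cdot> x) = c \<cdot> mirror v x" for x y c
    by (simp_all add: mirror_def poly_eq_iff add_divide_distrib algebra_simps)
  ultimately show ?thesis
    by (simp add: isom_def)
qed

lemma mirror_mirror: "mirror v (mirror v x) = x"
  by (cases "B v v = 0") (auto simp: mirror_def poly_eq_iff field_simps)

lemma mirror_invol: "mirror v \<circ> mirror v = id"
  by (rule ext) (simp add: mirror_mirror)

lemma mirror_smul: "c \<noteq> 0 \<Longrightarrow> mirror (c \<cdot> v) = mirror v"
  by (cases "B v v = 0") (auto simp: mirror_def poly_eq_iff field_simps)

lemma mirror_minus [simp]: "mirror (- v) = mirror v"
  by (auto simp: mirror_def poly_eq_iff)

lemma mirror_self: "B v v \<noteq> 0 \<Longrightarrow> mirror v v = - v"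
  by (auto simp: mirror_def poly_eq_iff field_simps)

lemma isom_mirror_conj:
  assumes "isom h" shows "h (mirror v x) = mirror (h v) (h x)"
  by (simp add: mirror_def isomD[OF assms])

lemma isom_mirror_comp:
  assumes "isom h" shows "h \<circ> mirror v = mirror (h v) \<circ> h"
  using isom_mirror_conj[OF assms] by auto

lemma isom_gen: "h \<in> gen S \<Longrightarrow> (\<And>s. s \<in> S \<Longrightarrow> isom s) \<Longrightarrow> isom h"
  by (induction rule: gen.induct) (simp_all add: isom_comp)

lemma isom_gen_mirror: "h \<in> gen (mirror ` N) \<Longrightarrow> isom h"
  by (rule isom_gen) auto

lemma gen_mirror_inverse:
  assumes "g \<in> gen (mirror ` N)"
  obtains h where "h \<in> gen (mirror ` N)" "g \<circ> h = id" "h \<circ> g = id"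
  by (rule gen_inverse[OF _ assms]) (auto simp: mirror_invol)

definition subsp :: "'a poly set \<Rightarrow> bool" where
  "subsp U \<longleftrightarrow> 0 \<in> U \<and> (\<forall>x\<in>U. \<forall>y\<in>U. x + y \<in> U) \<and> (\<forall>c. \<forall>x\<in>U. c \<cdot> x \<in> U)"

lemma subspD:
  assumes "subsp U"
  shows "0 \<in> U" "x \<in> U \<Longrightarrow> y \<in> U \<Longrightarrow> x + y \<in> U" "x \<in> U \<Longrightarrow> c \<cdot> x \<in> U"
    "x \<in> U \<Longrightarrow> - x \<in> U" "x \<in> U \<Longrightarrow> y \<in> U \<Longrightarrow> x - y \<in> U"
proof -
  show *: "0 \<in> U" "x \<in> U \<Longrightarrow> y \<in> U \<Longrightarrow> x + y \<in> U" "x \<in> U \<Longrightarrow> c \<cdot> x \<in> U" for x y c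
    using assms by (auto simp: subsp_def)
  have m: "- x = (-1) \<cdot> x" for x :: "'a poly" by simp
  show m': "x \<in> U \<Longrightarrow> - x \<in> U" for x using *(3)[of x "-1"] by (simp flip: m)
  show "x \<in> U \<Longrightarrow> y \<in> U \<Longrightarrow> x - y \<in> U" for x y using *(2)[of x "- y"] m' by simp
qed

lemma subsp_mirror: "subsp U \<Longrightarrow> v \<in> U \<Longrightarrow> x \<in> U \<Longrightarrow> mirror v x \<in> U"
  by (simp add: mirror_def subspD)

text \<open>A reflection moves any anisotropic \<open>e\<close> to any vector \<open>e'\<close> of the same length, up to sign, because
  \<open>e - e'\<close> and \<open>e + e'\<close> cannot both be isotropic. The radical of \<open>U\<close>, where nothing can be
  reflected, is allowed to be a line outside the radical of the whole space.\<close>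

lemma Cartan_Dieudonne:
  assumes "finite U" "subsp U" "isom h" "\<And>x. h x - x \<in> U"
    and "\<And>x y. x \<in> U \<Longrightarrow> y \<in> U \<Longrightarrow> (\<forall>z\<in>U. B x z = 0) \<Longrightarrow> (\<forall>z\<in>U. B y z = 0) \<Longrightarrow> x \<noteq> 0 \<Longrightarrow>
      \<exists>c. y = c \<cdot> x"
    and "\<And>x. x \<in> U \<Longrightarrow> \<forall>z. B x z = 0 \<Longrightarrow> x = 0"
  shows "h \<in> gen (mirror ` {v \<in> U. B v v \<noteq> 0})"
  using assms
proof (induction "card U" arbitrary: U h rule: less_induct)
  case less
  note U = subspD[OF less.prems(2)] and h = isomD[OF less.prems(3)]
  show ?case
  proof (cases "\<exists>e\<in>U. B e e \<noteq> 0")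
    case True
    then obtain e where e: "e \<in> U" "B e e \<noteq> 0" by blast
    \<comment> \<open>A map fixing \<open>e\<close> displaces vectors orthogonally to
      \<open>e\<close>, so the induction continues in this hyperplane. Since \<open>U\<close> is
      spanned by \<open>U'\<close> and \<open>e\<close>, the radical of \<open>U'\<close> lies in
      that of \<open>U\<close> and inherits the hypotheses.\<close>
    define U' where "U' = {x \<in> U. B x e = 0}"
    have dec: "x - (B x e / B e e) \<cdot> e \<in> U'" if "x \<in> U" for x
      using that e U by (auto simp: U'_def)
    have fixcase: "g \<in> gen (mirror ` {v \<in> U. B v v \<noteq> 0})"
      if g: "isom g" "\<And>x. g x - x \<in> U" "g e = e" for g
    proof -
      have orth: "(\<forall>z\<in>U. B x z = 0)" if "x \<in> U'" "\<forall>z\<in>U'. B x z = 0" for x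
      proof
        fix z assume "z \<in> U"
        from that(2) dec[OF this] have "B x (z - (B z e / B e e) \<cdot> e) = 0" by blast
        then show "B x z = 0" using that(1) by (simp add: U'_def)
      qed
      have "g \<in> gen (mirror ` {v \<in> U'. B v v \<noteq> 0})"
      proof (rule less.hyps[of U'])
        show "card U' < card U"
          by (rule psubset_card_mono) (use less.prems(1) e in \<open>auto simp: U'_def\<close>)
        show "finite U'" using less.prems(1) by (simp add: U'_def)
        show "subsp U'" using less.prems(2) by (auto simp: subsp_def U'_def)
        show "isom g" by fact
        show "g x - x \<in> U'" for x
          using g(2)[of x] isomD(3)[OF g(1), of x e] g(3) by (simp add: U'_def)
        show "\<exists>c. y = c \<cdot> x"
          if "x \<in> U'" "y \<in> U'" "\<forall>z\<in>U'. B x z = 0" "\<forall>z\<in>U'. B y z = 0" "x \<noteq> 0" for x y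
          using less.prems(5)[of x y] orth[OF that(1,3)] orth[OF that(2,4)] that
          by (auto simp: U'_def)
        show "x = 0" if "x \<in> U'" "\<forall>z. B x z = 0" for x
          using less.prems(6) that by (auto simp: U'_def)
      qed
      then show ?thesis
        using gen_mono[of "mirror ` {v \<in> U'. B v v \<noteq> 0}" "mirror ` {v \<in> U. B v v \<noteq> 0}"]
        by (auto simp: U'_def)
    qed
    have step: "h \<in> gen (mirror ` {v \<in> U. B v v \<noteq> 0})"
      if g: "g \<in> gen (mirror ` {v \<in> U. B v v \<noteq> 0})" "g (h e) = e" for g
    proof -
      obtain g' where g': "g' \<in> gen (mirror ` {v \<in> U. B v v \<noteq> 0})" "g' \<circ> g = id"
        by (rule gen_mirror_inverse[OF g(1)]) blast
      have gU: "g x - x \<in> U" for x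
        using g(1)
      proof induction
        case gen_id show ?case using U(1) by (simp only: id_apply diff_self)
      next
        case (gen_step s g)
        then obtain v where v: "v \<in> U" "s = mirror v" by blast
        have "s (g x) - x = (g x - x) - (2 * B (g x) v / B v v) \<cdot> v"
          by (simp add: v(2) mirror_def)
        also have "\<dots> \<in> U" by (intro U(5) gen_step.IH U(3) v(1))
        finally show ?case by simp
      qed
      have "g \<circ> h \<in> gen (mirror ` {v \<in> U. B v v \<noteq> 0})"
      proof (rule fixcase)
        show "isom (g \<circ> h)" by (intro isom_comp less.prems(3) isom_gen_mirror[OF g(1)])
        show "(g \<circ> h) x - x \<in> U" for x
          using U(2)[OF gU[of "h x"] less.prems(4)[of x]] by simp
      qed (simp add: g)
      then have "g' \<circ> (g \<circ> h) \<in> gen (mirror ` {v \<in> U. B v v \<noteq> 0})"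
        by (rule gen_comp[OF g'(1)])
      then show ?thesis using g'(2) by (simp flip: comp_assoc)
    qed
    define e' where "e' = h e"
    have e': "e' \<in> U" "B e' e' = B e e"
      using U(2)[OF less.prems(4)[of e] e(1)] h by (auto simp: e'_def)
    show ?thesis
    proof (cases "B (e' - e) (e' - e) = 0")
      case False
      have "mirror (e' - e) e' = e"
      proof -
        have "2 * B e' (e' - e) = B (e' - e) (e' - e)" using e' by (simp add: sym[of e e'])
        then have "2 * B e' (e' - e) / B (e' - e) (e' - e) = 1" using False by (simp del: diff_right diff_left)
        then show ?thesis by (auto simp: mirror_def poly_eq_iff simp del: diff_right diff_left)
      qed
      moreover have "mirror (e' - e) \<in> gen (mirror ` {v \<in> U. B v v \<noteq> 0})"
        by (rule gen_base) (use False U e' e in blast)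
      ultimately show ?thesis using step[of "mirror (e' - e)"] unfolding e'_def by blast
    next
      case True
      have "B (e' + e) (e' + e) + B (e' - e) (e' - e) = 2 * 2 * B e e"
        using e' by (simp add: algebra_simps)
      then have nz: "B (e' + e) (e' + e) \<noteq> 0" using True e by (metis add_0_right mult_eq_0_iff two)
      have "mirror (e' + e) e' = - e"
      proof -
        have "2 * B e' (e' + e) = B (e' + e) (e' + e)" using e' by (simp add: sym[of e e'])
        then have "2 * B e' (e' + e) / B (e' + e) (e' + e) = 1" using nz by (simp del: add_right add_left)
        then show ?thesis by (auto simp: mirror_def poly_eq_iff simp del: add_right add_left)
      qed
      then have "(mirror e \<circ> mirror (e' + e)) e' = e"
        using e by (simp add: isomD[OF isom_mirror] mirror_self)
      moreover have "mirror e \<circ> mirror (e' + e) \<in> gen (mirror ` {v \<in> U. B v v \<noteq> 0})"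
        by (rule gen_comp; rule gen_base) (use nz U e' e in auto)
      ultimately show ?thesis using step[of "mirror e \<circ> mirror (e' + e)"] unfolding e'_def by blast
    qed
  next
    case False
    have iso: "B x y = 0" if "x \<in> U" "y \<in> U" for x y
    proof -
      have "2 * B x y = B (x + y) (x + y) - B x x - B y y" by (simp add: sym[of y x])
      also have "\<dots> = 0" using False that U(2)[OF that] by (simp del: add_left add_right)
      finally show ?thesis by simp
    qed
    \<comment> \<open>\<open>U\<close> is now its own radical, hence zero or a line spanned by some
      \<open>u\<close>. Writing \<open>h x = x + l x \<cdot> u\<close>, preservation of the form
      gives \<open>l x * B u y + l y * B u x = 0\<close>, and a \<open>z\<close> with
      \<open>B u z \<noteq> 0\<close> forces \<open>l = 0\<close>.\<close>
    have "h x = x" for x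
    proof (cases "U = {0}")
      case True
      then show ?thesis using less.prems(4)[of x] by simp
    next
      case False
      then obtain u where u: "u \<in> U" "u \<noteq> 0" using U(1) by blast
      have ex: "\<exists>c. h x - x = c \<cdot> u" for x
        using less.prems(5)[of u "h x - x"] u less.prems(4)[of x] iso by blast
      define l where "l x = (SOME c. h x - x = c \<cdot> u)" for x
      have l: "h x = x + l x \<cdot> u" for x
        using someI_ex[OF ex[of x]] by (simp add: l_def algebra_simps)
      obtain z where z: "B u z \<noteq> 0" using less.prems(6)[OF u(1)] u(2) by blast
      have lu: "l x * B u y + l y * B u x = 0" for x y
        using h(3)[of x y] iso[OF u(1) u(1)] by (simp add: l sym[of x u])
      have "2 * (l z * B u z) = 0" using lu[of z z] by simp
      then have "l z = 0" using z by simp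
      then have "l x = 0" using lu[of x z] z by simp
      then show ?thesis by (simp add: l)
    qed
    then have "h = id" by (intro ext) simp
    then show ?thesis by (simp only: gen_id)
  qed
qed

lemma sum_left: "B (\<Sum>i\<in>A. f i) y = (\<Sum>i\<in>A. B (f i) y)"
  by (induction A rule: infinite_finite_induct) simp_all

lemma subsp_supp_in [simp]: "subsp (supp_in A)"
  by (simp add: subsp_def supp_in_def)

section \<open>Commutation and braid relations of mirrors\<close>

lemma mirror_commute:
  assumes "B v w = 0" shows "mirror v \<circ> mirror w = mirror w \<circ> mirror v"
proof -
  have "mirror v w = w" using assms by (simp add: mirror_def sym[of w v])
  then show ?thesis using isom_mirror_comp[OF isom_mirror[of v], of w] by simp
qed

text \<open>With \<open>c = \<plusminus> 1\<close> the two images \<open>mirror v w\<close> and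
  \<open>mirror w v\<close> are proportional, so their mirrors coincide. Allowing both signs of
  \<open>c\<close> covers the periods \<infinity> in characteristic 3, where the double product is 1
  instead of -1.\<close>

lemma mirror_braid:
  assumes v: "B v v = 1" and w: "B w w = 1" and c: "(2 * B v w)\<^sup>2 = 1"
  shows "mirror v \<circ> (mirror w \<circ> mirror v) = mirror w \<circ> (mirror v \<circ> mirror w)"
proof -
  define c where "c = 2 * B v w"
  have cc: "c * c = 1" "c \<noteq> 0" using assms(3) by (auto simp: c_def power2_eq_square)
  have "mirror v w = (- c) \<cdot> mirror w v"
    using v w cc by (simp add: mirror_def sym[of w v] smult_diff_right flip: c_def)
  then have eq: "mirror (mirror v w) = mirror (mirror w v)" using cc(2) mirror_smul[of "- c"] by (simp only: neg_equal_0_iff_equal not_False_eq_True)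
  have "mirror v \<circ> (mirror w \<circ> mirror v) = mirror (mirror v w) \<circ> (mirror v \<circ> mirror v)"
    using isom_mirror_comp[OF isom_mirror[of v], of w] by (simp only: flip: comp_assoc)
  also have "\<dots> = mirror (mirror w v) \<circ> (mirror w \<circ> mirror w)"
    by (simp only: eq mirror_invol)
  also have "\<dots> = mirror w \<circ> (mirror v \<circ> mirror w)"
    using isom_mirror_comp[OF isom_mirror[of w], of v] by (simp only: flip: comp_assoc)
  finally show ?thesis .
qed

end

section \<open>Nonsquares and pairs of reflections\<close>

text \<open>Squaring is at most two-to-one on nonzero elements, so the nonzero squares and their
  disjoint multiple by \<open>a\<close> together fill the nonzero elements; thus \<open>b\<close> is
  \<open>a\<close> times a square.\<close>

lemma nonsquare_mult:
  fixes a b :: "'a::field"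
  assumes fin: "finite (UNIV :: 'a set)" and two: "(2::'a) \<noteq> 0"
    and a: "\<forall>t. a \<noteq> t\<^sup>2" and b: "\<forall>t. b \<noteq> t\<^sup>2"
  shows "\<exists>t. a * b = t\<^sup>2"
proof -
  have f: "finite A" for A :: "'a set" using fin by (rule finite_subset[rotated]) simp
  define S where "S = (\<lambda>t::'a. t\<^sup>2) ` (UNIV - {0})"
  have a0: "a \<noteq> 0" and b0: "b \<noteq> 0" using a b by (metis power_zero_numeral)+
  have "UNIV - {0} = (\<Union>y\<in>S. {x. x\<^sup>2 = y} - {0})" by (auto simp: S_def)
  also have "card \<dots> \<le> (\<Sum>y\<in>S. card ({x. x\<^sup>2 = y} - {0}))"
    by (rule card_UN_le) (rule f)
  also have "\<dots> \<le> (\<Sum>y\<in>S. 2)"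
  proof (rule sum_mono)
    fix y assume "y \<in> S"
    then obtain x0 where "y = x0\<^sup>2" by (auto simp: S_def)
    then have "{x. x\<^sup>2 = y} - {0} \<subseteq> {x0, -x0}" by (auto simp: power2_eq_iff)
    then have "card ({x. x\<^sup>2 = y} - {0}) \<le> card {x0, -x0}" by (rule card_mono[OF f])
    also have "\<dots> \<le> 2" by (rule card_insert_le_m1) auto
    finally show "card ({x. x\<^sup>2 = y} - {0}) \<le> 2" .
  qed
  also have "\<dots> = card S + card ((*) a ` S)"
    using a0 by (simp add: card_image inj_on_def)
  also have "\<dots> = card (S \<union> (*) a ` S)"
  proof (rule card_Un_disjoint[OF f f, symmetric])
    have False if "s \<noteq> 0" "t \<noteq> 0" "s\<^sup>2 = a * t\<^sup>2" for s t
    proof -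
      have "a = (s / t)\<^sup>2" using that by (simp add: field_simps)
      then show False using a by blast
    qed
    then show "S \<inter> (*) a ` S = {}" by (auto simp: S_def)
  qed
  finally have "card (UNIV - {0::'a}) \<le> card (S \<union> (*) a ` S)" .
  moreover have "S \<union> (*) a ` S \<subseteq> UNIV - {0}" using a0 by (auto simp: S_def)
  ultimately have "S \<union> (*) a ` S = UNIV - {0}" by (meson card_seteq f)
  then have "b \<in> S \<union> (*) a ` S" using b0 by blast
  then obtain t where "b = a * t\<^sup>2" using b by (auto simp: S_def)
  then have "a * b = (a * t)\<^sup>2" by (simp add: power2_eq_square)
  then show ?thesis by blast
qed

lemma prod_involution:
  fixes f :: "'b \<Rightarrow> int"
  assumes "finite A" "\<And>x. x \<in> A \<Longrightarrow> i x \<in> A" "\<And>x. x \<in> A \<Longrightarrow> i (i x) = x"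
    "\<And>x. x \<in> A \<Longrightarrow> f (i x) = f x" "\<And>x. x \<in> A \<Longrightarrow> f x * f x = 1"
  shows "prod f A = prod f {x \<in> A. i x = x}"
  using assms
proof (induction "card A" arbitrary: A rule: less_induct)
  case less
  show ?case
  proof (cases "\<exists>x\<in>A. i x \<noteq> x")
    case True
    then obtain x where x: "x \<in> A" "i x \<noteq> x" by blast
    define A' where "A' = A - {x, i x}"
    have A: "A = insert x (insert (i x) A')" "x \<notin> insert (i x) A'" "i x \<notin> A'" "finite A'"
      using x less.prems by (auto simp: A'_def)
    have "prod f A' = prod f {x \<in> A'. i x = x}"
    proof (rule less.hyps)
      show "card A' < card A"
        by (rule psubset_card_mono) (use x less.prems(1) in \<open>auto simp: A'_def\<close>)
      show "i y \<in> A'" if "y \<in> A'" for y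
      proof -
        have "i y \<noteq> x" "i y \<noteq> i x" using that less.prems(3)[of y] less.prems(3)[OF x(1)] x
          by (auto simp: A'_def)
        then show ?thesis using that less.prems(2) by (auto simp: A'_def)
      qed
    qed (use less.prems in \<open>auto simp: A'_def\<close>)
    moreover have "prod f A = (f x * f x) * prod f A'"
      using A(2-4) less.prems(4)[OF x(1)] by (subst A(1)) (simp add: mult.assoc)
    moreover have "{x \<in> A. i x = x} = {x \<in> A'. i x = x}"
      using x less.prems(3)[OF x(1)] by (auto simp: A'_def)
    ultimately show ?thesis using less.prems(5)[OF x(1)] by simp
  next
    case False
    then have "{x \<in> A. i x = x} = A" by blast
    then show ?thesis by simp
  qed
qed

text \<open>The second assumption says that the field is prime, so that all scalars can be reached
  by counting upwards.\<close>

locale prime_form = bform B for B :: "'a::field poly \<Rightarrow> 'a poly \<Rightarrow> 'a" +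
  assumes fin: "finite (UNIV :: 'a set)"
    and prime_field: "\<And>x::'a. \<exists>m::nat. x = of_nat m"
begin

definition nonsq :: "'a \<Rightarrow> bool" where "nonsq a \<longleftrightarrow> (\<forall>t. a \<noteq> t\<^sup>2)"

lemma nonsq_nz: "nonsq a \<Longrightarrow> a \<noteq> 0"
  unfolding nonsq_def by (metis power_zero_numeral)

lemma nonsq_mult: "nonsq a \<Longrightarrow> nonsq b \<Longrightarrow> \<exists>t. a * b = t\<^sup>2"
  using nonsquare_mult[OF fin two] by (simp add: nonsq_def)

text \<open>The case of interest is \<open>a\<close> and \<open>d\<close> in the same, nonsquare
  class. There it suffices that some \<open>s^2 + 1\<close> is a nonsquare; otherwise the squares
  would be closed under adding 1 and exhaust the prime field.\<close>

lemma binary_form_represents_1: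
  assumes a: "nonsq a" and d: "d \<noteq> 0"
  shows "\<exists>x y. a * x\<^sup>2 + d * y\<^sup>2 = 1"
proof (cases "nonsq d")
  case False
  then obtain s where s: "d = s\<^sup>2" by (auto simp: nonsq_def)
  then have "a * 0\<^sup>2 + d * (1 / s)\<^sup>2 = 1" using d by (simp add: power_divide)
  then show ?thesis by blast
next
  case True
  obtain t where t: "a * d = t\<^sup>2" using nonsq_mult[OF a True] by blast
  have a0: "a \<noteq> 0" by (rule nonsq_nz[OF a])
  have t0: "t \<noteq> 0" using t a0 d by (metis mult_eq_0_iff power_zero_numeral)
  have "\<exists>s. nonsq (s\<^sup>2 + 1)"
  proof (rule ccontr)
    assume *: "\<not> ?thesis"
    have "\<exists>s::'a. of_nat m = s\<^sup>2" for m
    proof (induction m)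
      case 0 then show ?case by (intro exI[of _ 0]) simp
    next
      case (Suc m)
      then show ?case using * by (simp add: nonsq_def) (metis add.commute)
    qed
    then show False using a prime_field unfolding nonsq_def by metis
  qed
  then obtain s where s: "nonsq (s\<^sup>2 + 1)" by blast
  define n where "n = s\<^sup>2 + 1"
  have n: "nonsq n" "n \<noteq> 0" using s nonsq_nz by (auto simp: n_def)
  obtain r where r: "a * n = r\<^sup>2" using nonsq_mult[OF a n(1)] by blast
  have r0: "r \<noteq> 0" using r a0 n(2) by (metis mult_eq_0_iff power_zero_numeral)
  have "a * (s / r)\<^sup>2 + d * (a / (t * r))\<^sup>2 = 1"
  proof -
    have "d * a\<^sup>2 / (t\<^sup>2 * r\<^sup>2) = a / r\<^sup>2"
      unfolding t[symmetric] using a0 d r0 by (simp add: power2_eq_square)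
    then have "a * (s / r)\<^sup>2 + d * (a / (t * r))\<^sup>2 = a * (s\<^sup>2 + 1) / r\<^sup>2"
      by (simp add: power_divide power_mult_distrib algebra_simps add_divide_distrib)
    also have "\<dots> = 1" using r r0 by (simp add: n_def)
    finally show ?thesis .
  qed
  then show ?thesis by blast
qed

definition unit_vecs :: "'a poly set \<Rightarrow> 'a poly set" where
  "unit_vecs U = {v \<in> U. B v v = 1}"

lemma mirror_square_norm:
  assumes U: "subsp U" and x: "x \<in> U" "B x x \<noteq> 0" "\<not> nonsq (B x x)"
  shows "\<exists>y\<in>unit_vecs U. mirror x = mirror y"
proof -
  obtain t where t: "B x x = t\<^sup>2" using x(3) by (auto simp: nonsq_def)
  then have "t \<noteq> 0" using x(2) by auto
  then have "(1 / t) \<cdot> x \<in> unit_vecs U" "mirror x = mirror ((1 / t) \<cdot> x)"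
    using t subspD(3)[OF U x(1)] by (simp_all add: unit_vecs_def mirror_smul power2_eq_square)
  then show ?thesis by blast
qed

text \<open>In the Clifford algebra of the plane, \<open>e v w\<close> is a vector \<open>x\<close>, so \<open>v w = e x\<close> when \<open>e\<close> is a
  unit vector; and \<open>x\<close> has square length because the lengths of \<open>v\<close> and \<open>w\<close> are both nonsquares.\<close>

lemma mirror_pair_plane:
  assumes U: "subsp U" and v: "v \<in> U" "nonsq (B v v)" and w: "w \<in> U" "nonsq (B w w)"
    and nd: "B v v * B w w \<noteq> (B v w)\<^sup>2"
  shows "mirror v \<circ> mirror w \<in> gen (mirror ` unit_vecs U)"
proof -
  define a b s where "a = B v v" and "b = B w w" and "s = B v w"
  have a: "a \<noteq> 0" and b: "b \<noteq> 0" using v w nonsq_nz by (auto simp: a_def b_def)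
  have "b - s\<^sup>2 / a \<noteq> 0" using nd a by (simp add: a_def b_def s_def field_simps)
  then obtain X Y where XY: "a * X\<^sup>2 + (b - s\<^sup>2 / a) * Y\<^sup>2 = 1"
    using binary_form_represents_1 v(2) a_def by blast
  \<comment> \<open>\<open>v\<close> and \<open>w - (s / a) \<cdot> v\<close> diagonalise the form
    on the plane, with lengths \<open>a\<close> and \<open>b - s^2 / a\<close>; these are the
    coordinates of the unit vector \<open>e\<close> translated back to \<open>v\<close> and
    \<open>w\<close>.\<close>
  define al be where "al = X - Y * s / a" and "be = Y"
  have Q: "al * al * a + 2 * al * be * s + be * be * b = 1"
    unfolding al_def be_def XY[symmetric] using a by (simp add: field_simps power2_eq_square)
  define e where "e = al \<cdot> v + be \<cdot> w"
  \<comment> \<open>The Clifford product \<open>e v w\<close>, expanded with \<open>v v = a\<close>,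
    \<open>w w = b\<close> and \<open>v w + w v = 2 s\<close>.\<close>
  define x where "x = (al * a + 2 * be * s) \<cdot> w - (be * b) \<cdot> v"
  have Bs: "B v v = a" "B w w = b" "B v w = s" "B w v = s"
    by (simp_all add: a_def b_def s_def sym[of w v])
  have ee: "B e e = 1" using Q by (simp add: e_def Bs algebra_simps)
  have xx: "B x x = a * b"
  proof -
    have "B x x = a * b * (al * al * a + 2 * al * be * s + be * be * b)"
      by (simp add: x_def Bs algebra_simps)
    then show ?thesis using Q by simp
  qed
  have xe: "B x e = s"
  proof -
    have "B x e = s * (al * al * a + 2 * al * be * s + be * be * b)"
      by (simp add: x_def e_def Bs algebra_simps)
    then show ?thesis using Q by simp
  qed
  have eU: "e \<in> U" "x \<in> U" using U v w by (simp_all add: e_def x_def subspD)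
  have "mirror v (mirror w y) = mirror e (mirror x y)" for y
  proof -
    define m n where "m = B y v" and "n = B y w"
    have By: "B y v = m" "B y w = n" by (simp_all add: m_def n_def)
    define xi where "xi = (al * a + 2 * be * s) * n - be * b * m"
    have yx: "B y x = xi" "B y e = al * m + be * n" by (simp_all add: x_def e_def By xi_def)
    define f where "f = 2 * (al * m + be * n - 2 * xi / (a * b) * s)"
    have R: "mirror e (mirror x y) = y - (2 * xi / (a * b)) \<cdot> x - f \<cdot> e"
      by (simp add: mirror_def xx ee xe yx f_def)
    have L: "mirror v (mirror w y) = y - (2 * n / b) \<cdot> w - (2 * (m - 2 * n / b * s) / a) \<cdot> v"
      by (simp add: mirror_def Bs By)
    define k l where "k = 2 * xi / (a * b)" and "l = n / b"
    have k: "k * a * b = 2 * ((al * a + 2 * be * s) * n - be * b * m)" and n: "n = l * b"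
      using a b by (simp_all add: k_def l_def xi_def)
    have f: "f = 2 * (al * m + be * n - k * s)" by (simp add: f_def k_def)
    have c1: "2 * (m - 2 * n / b * s) / a = f * al - 2 * xi / (a * b) * (be * b)"
    proof -
      have "b * (2 * (m - 2 * l * s)) = b * (a * (f * al - k * (be * b)))"
        using k n Q unfolding f by Groebner_Basis.algebra
      then have "2 * (m - 2 * l * s) = a * (f * al - k * (be * b))" using b by simp
      then have "2 * (m - 2 * l * s) / a = f * al - k * (be * b)" using a by simp
      then show ?thesis by (simp add: l_def k_def)
    qed
    have c2: "2 * n / b = f * be + 2 * xi / (a * b) * (al * a + 2 * be * s)"
    proof -
      have "(a * b) * (2 * l) = (a * b) * (f * be + k * (al * a + 2 * be * s))"
        using k n Q unfolding f by Groebner_Basis.algebra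
      then have "2 * l = f * be + k * (al * a + 2 * be * s)"
        using a b by (metis mult_cancel_left mult_eq_0_iff)
      then show ?thesis by (simp add: l_def k_def)
    qed
    show ?thesis unfolding L R c1 unfolding c2 k_def[symmetric]
      by (simp add: x_def e_def poly_eq_iff algebra_simps)
  qed
  then have "mirror v \<circ> mirror w = mirror e \<circ> mirror x" by (intro ext) simp
  moreover have "mirror x \<in> mirror ` unit_vecs U"
  proof -
    have "\<not> nonsq (B x x)" using nonsq_mult v(2) w(2) by (auto simp: xx a_def b_def nonsq_def)
    then show ?thesis using mirror_square_norm[OF U eU(2)] a b by (force simp: xx)
  qed
  moreover have "mirror e \<in> mirror ` unit_vecs U" using ee eU by (auto simp: unit_vecs_def)
  ultimately show ?thesis using gen_comp gen_base by metis
qed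

text \<open>In a degenerate plane, \<open>w\<close> can be rescaled to \<open>w' = v + u\<close>
  with \<open>u\<close> isotropic and orthogonal to \<open>v\<close>. A third vector
  \<open>y\<close> of the same length, spanning nondegenerate planes with both \<open>v\<close> and
  \<open>w'\<close>, is then inserted: its two mirrors cancel.\<close>

lemma mirror_pair:
  assumes U: "subsp U" and v: "v \<in> U" "nonsq (B v v)" and w: "w \<in> U" "nonsq (B w w)"
    and e: "e \<in> U" "B e e = 1" and three: "(3::'a) \<noteq> 0"
  shows "mirror v \<circ> mirror w \<in> gen (mirror ` unit_vecs U)"
proof (cases "B v v * B w w = (B v w)\<^sup>2")
  case False
  then show ?thesis using mirror_pair_plane[OF U v w] by blast
next
  case True
  define a where "a = B v v"
  have a: "a \<noteq> 0" "nonsq a" using v nonsq_nz by (auto simp: a_def)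
  have s: "B v w \<noteq> 0" using True v w nonsq_nz by (metis mult_eq_0_iff power_zero_numeral)
  define w' where "w' = (a / B v w) \<cdot> w"
  have mw: "mirror w = mirror w'" unfolding w'_def using a s by (simp add: mirror_smul)
  define u where "u = w' - v"
  have vw': "B v w' = a" using s by (simp add: w'_def)
  have ww': "B w' w' = a" using s a True
    by (simp add: w'_def power2_eq_square field_simps flip: a_def)
  have u: "B u v = 0" "B v u = 0" "B u u = 0" "w' = v + u" "u \<in> U"
    using vw' ww' U v w by (simp_all add: u_def w'_def[symmetric] sym[of w' v] flip: a_def)
      (simp_all add: w'_def subspD)
  have Bv: "B v v = a" by (simp add: a_def)
  have key: "mirror v \<circ> mirror w' \<in> gen (mirror ` unit_vecs U)"
    if y: "y \<in> U" "B y y = a" "(B v y)\<^sup>2 \<noteq> a\<^sup>2" "(B y w')\<^sup>2 \<noteq> a\<^sup>2" for y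
  proof -
    have "mirror v \<circ> mirror y \<in> gen (mirror ` unit_vecs U)"
      by (rule mirror_pair_plane[OF U v y(1)]) (use y a Bv in \<open>auto simp: power2_eq_square\<close>)
    moreover have "mirror y \<circ> mirror w' \<in> gen (mirror ` unit_vecs U)"
      by (rule mirror_pair_plane[OF U y(1)])
        (use y a ww' U v u in \<open>auto simp: power2_eq_square subspD simp del: add_left add_right\<close>)
    ultimately have "(mirror v \<circ> mirror y) \<circ> (mirror y \<circ> mirror w') \<in> gen (mirror ` unit_vecs U)"
      by (rule gen_comp)
    moreover have "(mirror v \<circ> mirror y) \<circ> (mirror y \<circ> mirror w') = mirror v \<circ> mirror w'"
      by (intro ext) (simp add: mirror_mirror)
    ultimately show ?thesis by (simp only:)
  qed
  show ?thesis unfolding mw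
  proof (cases "\<exists>z\<in>U. B z u \<noteq> 0")
    case True
    then obtain z0 where z0: "z0 \<in> U" "B z0 u \<noteq> 0" by blast
    define z1 where "z1 = (1 / B z0 u) \<cdot> (z0 - (B z0 v / a) \<cdot> v)"
    define z where "z = z1 - (B z1 z1 / 2) \<cdot> u"
    have z1: "B z1 u = 1" "B u z1 = 1" "B z1 v = 0" "B v z1 = 0" "z1 \<in> U"
    proof -
      show "B z1 u = 1" "B z1 v = 0" using z0 a u by (simp_all add: z1_def flip: a_def)
      then show "B u z1 = 1" "B v z1 = 0" by (simp_all add: sym)
      show "z1 \<in> U" using z0 U v by (simp add: z1_def subspD)
    qed
    have z: "B z u = 1" "B u z = 1" "B z v = 0" "B v z = 0" "B z z = 0" "z \<in> U"
      using z1 u U by (simp_all add: z_def subspD)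
    \<comment> \<open>\<open>z\<close> is a hyperbolic partner of \<open>u\<close> orthogonal to
      \<open>v\<close>, so \<open>B y y = 2 * (1/4) * (2 * a) = a\<close>, \<open>B v y = 0\<close>
      and \<open>B y w' = 2 * a\<close>. Here \<open>3 \<noteq> 0\<close> separates
      \<open>(2 * a)^2\<close> from \<open>a^2\<close>.\<close>
    define y where "y = (1 / (2 * 2)) \<cdot> u + (2 * a) \<cdot> z"
    show "mirror v \<circ> mirror w' \<in> gen (mirror ` unit_vecs U)"
    proof (rule key)
      show "y \<in> U" using z u U by (simp add: y_def subspD)
      show "B y y = a" using z u by (simp add: y_def)
      show "(B v y)\<^sup>2 \<noteq> a\<^sup>2" using z u a by (simp add: y_def)
      have "B y w' = 2 * a" using z u by (simp add: y_def)
      moreover have "(2 * a)\<^sup>2 = a\<^sup>2 + 3 * a\<^sup>2" by (simp add: power2_eq_square)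
      moreover have "3 * a\<^sup>2 \<noteq> 0" using three a by simp
      ultimately show "(B y w')\<^sup>2 \<noteq> a\<^sup>2" by (metis add_cancel_right_right)
    qed
  next
    case False
    \<comment> \<open>Now \<open>u\<close> is orthogonal to \<open>U\<close>, so \<open>y\<close>
      has the same product with \<open>w'\<close> as with \<open>v\<close>. The part
      \<open>x\<close> of the unit vector \<open>e\<close> orthogonal to \<open>v\<close> is
      anisotropic, since otherwise \<open>a\<close> would be the square of
      \<open>B e v\<close>.\<close>
    define x where "x = e - (B e v / a) \<cdot> v"
    define d where "d = B x x"
    have x: "B x v = 0" "B v x = 0" "x \<in> U"
    proof -
      show "B x v = 0" using a by (simp add: x_def Bv)
      then show "B v x = 0" by (simp add: sym)
      show "x \<in> U" using e v U by (simp add: x_def subspD)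
    qed
    have d: "d \<noteq> 0"
    proof
      assume "d = 0"
      moreover have "d = 1 - (B e v)\<^sup>2 / a"
        using a e by (simp add: d_def x_def Bv sym[of v e] power2_eq_square)
      ultimately have "a = (B e v)\<^sup>2" using a by (simp add: field_simps)
      then show False using a unfolding nonsq_def by blast
    qed
    have "a + d \<noteq> 0 \<or> a + 2 * 2 * d \<noteq> 0"
    proof (rule ccontr)
      assume "\<not> ?thesis"
      then have "(a + 2 * 2 * d) - (a + d) = 0" by simp
      then have "3 * d = 0" by (simp add: algebra_simps)
      then show False using d three by simp
    qed
    then obtain t where t: "t \<noteq> 0" "a + t * t * d \<noteq> 0"
      by (metis mult.left_neutral mult_1 one_neq_zero two)
    define g where "g = a + t * t * d"
    have g: "g \<noteq> 0" using t by (simp add: g_def)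
    define k where "k = 2 * a / g"
    have k: "k * g = 2 * a" "k \<noteq> 0" using g a by (simp_all add: k_def)
    \<comment> \<open>The mirror image of \<open>v\<close> in \<open>v + t \<cdot> x\<close>, whose
      length is \<open>g\<close>; trying \<open>t = 1\<close> and \<open>t = 2\<close> guarantees
      \<open>g \<noteq> 0\<close>.\<close>
    define y where "y = (1 - k) \<cdot> v - (k * t) \<cdot> x"
    have Bx: "B x x = d" by (simp add: d_def)
    have yu: "B y u = 0" using False v x U by (simp add: y_def)
    have yv: "B y v = (1 - k) * a" "B v y = (1 - k) * a"
      using x by (simp_all add: y_def Bv)
    have yy: "B y y = a"
    proof -
      have "B y y = (1 - k) * (1 - k) * a + k * k * (t * t * d)"
        using x by (simp add: y_def Bv Bx algebra_simps)
      also have "\<dots> = a - 2 * k * a + k * (k * g)" by (simp add: g_def algebra_simps)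
      also have "\<dots> = a" unfolding k(1) by simp
      finally show ?thesis .
    qed
    have ne: "((1 - k) * a)\<^sup>2 \<noteq> a\<^sup>2"
    proof
      assume "((1 - k) * a)\<^sup>2 = a\<^sup>2"
      then have "k * a\<^sup>2 * (k - 2) = 0" by Groebner_Basis.algebra
      then have "k = 2" using a k(2) by simp
      then have "a = g" using k(1) by simp
      then show False using t d by (simp add: g_def)
    qed
    show "mirror v \<circ> mirror w' \<in> gen (mirror ` unit_vecs U)"
      by (rule key[of y]) (use U v x yy yv yu ne u in \<open>auto simp: y_def[symmetric]\<close>,
          simp add: y_def U v x subspD)
  qed
qed

section \<open>A substitute for the spinor norm\<close>

text \<open>\<open>half x\<close> selects one of \<open>x\<close> and \<open>- x\<close> for every \<open>x \<noteq> 0\<close>.\<close>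

definition half :: "'a poly \<Rightarrow> bool" where
  "half x \<longleftrightarrow> x = (SOME y. y \<in> {x, - x})"

definition half_sign :: "'a poly \<Rightarrow> int" where
  "half_sign x = (if half x then 1 else -1)"

definition half_sphere :: "'a poly set \<Rightarrow> 'a \<Rightarrow> 'a poly set" where
  "half_sphere V c = {x \<in> V. B x x = c \<and> half x}"

text \<open>As in Gauss' lemma on quadratic residues, counting the points of a half sphere that leave it
  gives a sign character; it takes the place of the spinor norm.\<close>

definition spin :: "'a poly set \<Rightarrow> 'a \<Rightarrow> ('a poly \<Rightarrow> 'a poly) \<Rightarrow> int" where
  "spin V c h = (\<Prod>x\<in>half_sphere V c. half_sign (h x))"

definition to_half :: "'a poly \<Rightarrow> 'a poly" where
  "to_half x = (if half x then x else - x)"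

lemma neg_neq: "x \<noteq> 0 \<Longrightarrow> - x \<noteq> x" for x :: "'a poly"
proof
  assume "- x = x" "x \<noteq> 0"
  then have "2 \<cdot> x = 0" by (metis ab_left_minus mult_2 one_add_one smult_1_left smult_add_left)
  then show False using \<open>x \<noteq> 0\<close> by simp
qed

lemma half_minus: "x \<noteq> 0 \<Longrightarrow> half (- x) \<longleftrightarrow> \<not> half x"
proof -
  assume x: "x \<noteq> 0"
  define y where "y = (SOME y. y \<in> {x, - x})"
  have y': "y = (SOME y. y \<in> {- x, - (- x)})" by (simp add: y_def insert_commute)
  have "y \<in> {x, - x}" unfolding y_def by (rule someI[of _ x]) simp
  then show ?thesis using neg_neq[OF x] unfolding half_def y_def[symmetric] y'[symmetric] by auto
qed

lemma half_to_half: "x \<noteq> 0 \<Longrightarrow> half (to_half x)"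
  by (simp add: to_half_def half_minus)

lemma half_sign_minus: "x \<noteq> 0 \<Longrightarrow> half_sign (- x) = - half_sign x"
  by (simp add: half_sign_def half_minus)

lemma half_sign_sq [simp]: "half_sign x * half_sign x = 1"
  by (simp add: half_sign_def)

lemma to_half_cases: "to_half x = x \<and> half_sign x = 1 \<or> to_half x = - x \<and> half_sign x = -1"
  by (simp add: to_half_def half_sign_def)

text \<open>Up to signs \<open>g\<close> permutes the half sphere, via \<open>t\<close>. Replacing
  \<open>g x\<close> by \<open>t x\<close> under \<open>h\<close> costs exactly the sign
  \<open>half_sign (g x)\<close>, and these signs multiply to \<open>spin V c g\<close>.\<close>

lemma spin_comp:
  assumes V: "finite V" "subsp V" and c: "c \<noteq> 0"
    and g: "isom g" "\<And>x. x \<in> V \<Longrightarrow> g x \<in> V" "inj g" and h: "isom h" "\<And>x. x \<in> V \<Longrightarrow> h x \<in> V"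
  shows "spin V c (h \<circ> g) = spin V c h * spin V c g"
proof -
  let ?P = "half_sphere V c"
  define t where "t x = to_half (g x)" for x
  have nz: "x \<noteq> 0" if "B x x = c" for x using that c by auto
  have gc: "B (g x) (g x) = c" if "x \<in> ?P" for x
    using that isomD(3)[OF g(1)] by (simp add: half_sphere_def)
  have t: "t x \<in> ?P" if "x \<in> ?P" for x
    using that gc[OF that] half_to_half[OF nz] g(2) subspD(4)[OF V(2)]
    by (auto simp: half_sphere_def t_def to_half_def)
  have inj: "inj_on t ?P"
  proof
    fix x y assume xy: "x \<in> ?P" "y \<in> ?P" "t x = t y"
    have "g x = g y \<or> g x = - g y"
      using xy(3) unfolding t_def by (auto simp: to_half_def split: if_splits) (metis minus_minus)
    then have "x = y \<or> x = - y"
      using injD[OF g(3)] isomD(4)[OF g(1)] by metis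
    moreover have "x \<noteq> - y"
      using xy half_minus[of y] nz by (auto simp: half_sphere_def)
    ultimately show "x = y" by blast
  qed
  have finP: "finite ?P" using V(1) by (simp add: half_sphere_def)
  have bij: "bij_betw t ?P ?P"
    using inj t finP by (simp add: bij_betw_def endo_inj_surj image_subsetI)
  have e: "half_sign (h (g x)) = half_sign (h (t x)) * half_sign (g x)" if "x \<in> ?P" for x
  proof -
    have "B (h (g x)) (h (g x)) = c" using gc[OF that] isomD(3)[OF h(1)] by simp
    then have "h (g x) \<noteq> 0" by (rule nz)
    then show ?thesis using to_half_cases[of "g x"] isomD(4)[OF h(1)]
      by (auto simp: t_def half_sign_minus)
  qed
  have "spin V c (h \<circ> g) = (\<Prod>x\<in>?P. half_sign (h (t x))) * spin V c g"
    unfolding spin_def comp_apply prod.distrib[symmetric] by (rule prod.cong[OF refl e])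
  also have "(\<Prod>x\<in>?P. half_sign (h (t x))) = spin V c h"
    unfolding spin_def by (rule prod.reindex_bij_betw[OF bij])
  finally show ?thesis .
qed

text \<open>The points \<open>x\<close> and \<open>\<plusminus> mirror v x\<close> of the half sphere contribute equal signs, so only the points
  with \<open>mirror v x = \<plusminus> x\<close> count, and among these only the multiples of \<open>v\<close> contribute \<open>- 1\<close>.\<close>

lemma spin_mirror:
  assumes V: "finite V" "subsp V" and c: "c \<noteq> 0" and v: "v \<in> V" "B v v \<noteq> 0"
  shows "spin V c (mirror v) = (if \<exists>t. c = t\<^sup>2 * B v v then -1 else 1)"
proof -
  let ?P = "half_sphere V c"
  let ?i = "\<lambda>x. to_half (mirror v x)"
  have nz: "x \<noteq> 0" if "B x x = c" for x using that c by auto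
  have P: "x \<in> ?P \<longleftrightarrow> x \<in> V \<and> B x x = c \<and> half x" for x by (simp add: half_sphere_def)
  have mc: "B (mirror v x) (mirror v x) = B x x" for x by (rule isomD(3)[OF isom_mirror])
  have mV: "mirror v x \<in> V" if "x \<in> V" for x by (rule subsp_mirror[OF V(2) v(1) that])
  have neg: "mirror v (- x) = - mirror v x" for x by (rule isomD(4)[OF isom_mirror])
  have finP: "finite ?P" using V(1) by (simp add: half_sphere_def)
  have "spin V c (mirror v) = (\<Prod>x\<in>{x \<in> ?P. ?i x = x}. half_sign (mirror v x))"
    unfolding spin_def
  proof (rule prod_involution[OF finP])
    fix x assume x: "x \<in> ?P"
    then have x': "x \<in> V" "B x x = c" "half x" "x \<noteq> 0" using nz P by blast+
    have m0: "mirror v x \<noteq> 0" using nz mc x' by metis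
    show "?i x \<in> ?P"
      using x' mV[OF x'(1)] mc[of x] half_to_half[OF m0] subspD(4)[OF V(2)] unfolding P
      by (auto simp: to_half_def)
    have "to_half x = x" "to_half (- x) = x"
      using x' half_minus[OF x'(4)] by (simp_all add: to_half_def)
    then show "?i (?i x) = x" using to_half_cases[of "mirror v x"] by (auto simp: neg mirror_mirror)
    have "half_sign x = 1" "half_sign (- x) = -1"
      using x' half_minus[OF x'(4)] by (simp_all add: half_sign_def)
    then show "half_sign (mirror v (?i x)) = half_sign (mirror v x)"
      using to_half_cases[of "mirror v x"] by (auto simp: neg mirror_mirror)
  qed simp
  also have "\<dots> = (\<Prod>x\<in>{x \<in> ?P. \<exists>t. x = t \<cdot> v}. half_sign (mirror v x))"
  proof (rule prod.mono_neutral_right)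
    show "finite {x \<in> ?P. ?i x = x}" using finP by simp
    have mt: "mirror v (t \<cdot> v) = - (t \<cdot> v)" for t
      using v by (simp add: isomD(2)[OF isom_mirror] mirror_self)
    show "{x \<in> ?P. \<exists>t. x = t \<cdot> v} \<subseteq> {x \<in> ?P. ?i x = x}"
    proof clarify
      fix t assume "t \<cdot> v \<in> ?P"
      then show "?i (t \<cdot> v) = t \<cdot> v"
        unfolding mt using half_minus[of "t \<cdot> v"] nz[of "t \<cdot> v"] by (simp add: P to_half_def)
    qed
    show "\<forall>x\<in>{x \<in> ?P. ?i x = x} - {x \<in> ?P. \<exists>t. x = t \<cdot> v}. half_sign (mirror v x) = 1"
    proof
      fix x assume x: "x \<in> {x \<in> ?P. ?i x = x} - {x \<in> ?P. \<exists>t. x = t \<cdot> v}"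
      show "half_sign (mirror v x) = 1"
      proof (rule ccontr)
        assume "half_sign (mirror v x) \<noteq> 1"
        then have "mirror v x = - x" using x to_half_cases[of "mirror v x"] by (metis (mono_tags, lifting) DiffD1 mem_Collect_eq minus_minus)
        then have "x + x = (2 * B x v / B v v) \<cdot> v" by (simp add: mirror_def algebra_simps)
        then have "(1 / 2) \<cdot> (2 \<cdot> x) = (1 / 2) \<cdot> (2 * B x v / B v v) \<cdot> v"
          by (metis mult_2 one_add_one smult_1_left smult_add_left)
        then have "x = (1 / 2 * (2 * B x v / B v v)) \<cdot> v" by simp
        then show False using x by blast
      qed
    qed
  qed
  also have "\<dots> = (if \<exists>t. c = t\<^sup>2 * B v v then -1 else 1)"
  proof (cases "\<exists>t. c = t\<^sup>2 * B v v")
    case False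
    then have "{x \<in> ?P. \<exists>t. x = t \<cdot> v} = {}" by (auto simp: P power2_eq_square mult.assoc)
    then show ?thesis using False by (simp only: prod.empty if_False)
  next
    case True
    then obtain t where t: "c = t\<^sup>2 * B v v" by blast
    define x where "x = to_half (t \<cdot> v)"
    have tv: "B (t \<cdot> v) (t \<cdot> v) = c" by (simp add: t power2_eq_square)
    have x: "x \<in> ?P" "x = t \<cdot> v \<or> x = (- t) \<cdot> v"
      using half_to_half[OF nz[OF tv]] tv v subspD(3,4)[OF V(2)]
      unfolding P x_def by (auto simp: to_half_def)
    have x0: "x \<noteq> 0" using x(1) nz P by blast
    have "{x \<in> ?P. \<exists>t. x = t \<cdot> v} = {x}"
    proof
      show "{x} \<subseteq> {x \<in> ?P. \<exists>t. x = t \<cdot> v}" using x by blast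
      show "{x \<in> ?P. \<exists>t. x = t \<cdot> v} \<subseteq> {x}"
      proof clarify
        fix s assume s: "s \<cdot> v \<in> ?P"
        then have "s\<^sup>2 * B v v = t\<^sup>2 * B v v" unfolding t[symmetric] by (simp add: P power2_eq_square mult.assoc)
        then have "s = t \<or> s = - t" using v(2) by (simp add: power2_eq_iff)
        then have "s \<cdot> v = x \<or> s \<cdot> v = - x" using x(2) by auto
        then show "s \<cdot> v = x" using s x(1) half_minus[OF x0] by (auto simp: P)
      qed
    qed
    moreover have "mirror v x = - x" using x(2) v by (auto simp: isomD[OF isom_mirror] mirror_self)
    ultimately show ?thesis using True x(1) x0 by (simp add: half_sign_minus) (simp add: half_sign_def P)
  qed
  finally show ?thesis .
qed

lemma gen_mirror_maps: "subsp V \<Longrightarrow> N \<subseteq> V \<Longrightarrow> g \<in> gen (mirror ` N) \<Longrightarrow> x \<in> V \<Longrightarrow> g x \<in> V"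
proof (rotate_tac 2, induction arbitrary: x rule: gen.induct)
  case (gen_step s g)
  then show ?case using subsp_mirror by (metis comp_apply imageE subsetD)
qed simp

lemma inj_gen_mirror:
  assumes "g \<in> gen (mirror ` N)" shows "inj g"
proof -
  obtain h where h: "h \<circ> g = id" by (rule gen_mirror_inverse[OF assms])
  show ?thesis by (rule injI) (metis h comp_apply id_apply)
qed

lemma spin_gen_unit:
  assumes V: "finite V" "subsp V" and c: "nonsq c" and h: "h \<in> gen (mirror ` unit_vecs V)"
  shows "spin V c h = 1"
  using h
proof induction
  case gen_id
  show ?case unfolding spin_def
    by (rule prod.neutral) (simp add: half_sphere_def half_sign_def)
next
  case (gen_step s g)
  then obtain v where v: "v \<in> V" "B v v = 1" "s = mirror v" by (auto simp: unit_vecs_def)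
  have N: "unit_vecs V \<subseteq> V" by (auto simp: unit_vecs_def)
  have "spin V c s = 1"
    using spin_mirror[OF V nonsq_nz[OF c] v(1)] v c by (simp add: nonsq_def)
  moreover have "spin V c (s \<circ> g) = spin V c s * spin V c g"
    unfolding v(3)
    by (rule spin_comp[OF V nonsq_nz[OF c] isom_gen_mirror[OF gen_step.hyps(2)]
          gen_mirror_maps[OF V(2) N gen_step.hyps(2)] inj_gen_mirror[OF gen_step.hyps(2)]
          isom_mirror subsp_mirror[OF V(2) v(1)]])
  ultimately show ?case using gen_step.IH by (simp only: mult_1)
qed

text \<open>Mirrors of nonsquare length are merged in pairs, so at most one survives, in some
  \<open>w\<close>. The character is taken on \<open>V\<close> with radius \<open>c = B w w\<close>:
  only in \<open>V\<close> is \<open>h\<close> known to be a product of unit mirrors, which gives it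
  the value 1, whereas a surviving \<open>mirror w\<close> would give -1.\<close>

lemma isom_in_unit_mirrors:
  assumes V: "finite V" "subsp V" and W: "W \<subseteq> V" "subsp W" and e: "e \<in> W" "B e e = 1"
    and three: "(3::'a) \<noteq> 0"
    and h: "h \<in> gen (mirror ` unit_vecs V)" "\<And>x. h x - x \<in> W"
    and rad: "\<And>x y. x \<in> W \<Longrightarrow> y \<in> W \<Longrightarrow> (\<forall>z\<in>W. B x z = 0) \<Longrightarrow> (\<forall>z\<in>W. B y z = 0) \<Longrightarrow> x \<noteq> 0 \<Longrightarrow>
      \<exists>c. y = c \<cdot> x"
    and rad': "\<And>x. x \<in> W \<Longrightarrow> \<forall>z. B x z = 0 \<Longrightarrow> x = 0"
  shows "h \<in> gen (mirror ` unit_vecs W)"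
proof -
  let ?H = "gen (mirror ` unit_vecs W)"
  have "h \<in> gen (mirror ` {v \<in> W. B v v \<noteq> 0})"
    using W V(1) by (intro Cartan_Dieudonne h(2) isom_gen_mirror[OF h(1)] rad rad') (auto intro: finite_subset)
  then have "h \<in> ?H \<or> (\<exists>w\<in>W. nonsq (B w w) \<and> (\<exists>g\<in>?H. h = mirror w \<circ> g))"
  proof induction
    case gen_id then show ?case using gen.gen_id by blast
  next
    case (gen_step s f)
    then obtain v where v: "v \<in> W" "B v v \<noteq> 0" "s = mirror v" by auto
    show ?case
    proof (cases "nonsq (B v v)")
      case True
      have "mirror v \<circ> (mirror w \<circ> g) \<in> ?H" if "w \<in> W" "nonsq (B w w)" "g \<in> ?H" for w g
        using gen_comp[OF mirror_pair[OF W(2) v(1) True that(1,2) e three] that(3)]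
        by (simp only: comp_assoc)
      then show ?thesis using gen_step.IH True v by blast
    next
      case False
      have s: "s \<in> ?H" using mirror_square_norm[OF W(2) v(1,2) False] v(3) by (metis gen_base imageI)
      \<comment> \<open>A unit mirror moves past the surviving nonsquare one, replacing
        \<open>w\<close> by an image of the same length.\<close>
      have "s \<circ> (mirror w \<circ> g) = mirror (mirror v w) \<circ> (s \<circ> g)" for w g
        using isom_mirror_comp[OF isom_mirror[of v], of w] v(3) by (simp flip: comp_assoc)
      moreover have "mirror v w \<in> W" "B (mirror v w) (mirror v w) = B w w" if "w \<in> W" for w
        using that v W(2) by (simp_all add: subsp_mirror isomD(3)[OF isom_mirror])
      ultimately show ?thesis using gen_step.IH gen_comp[OF s] by metis
    qed
  qed
  then show ?thesis
  proof
    assume "\<exists>w\<in>W. nonsq (B w w) \<and> (\<exists>g\<in>?H. h = mirror w \<circ> g)"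
    then obtain w g where w: "w \<in> W" "nonsq (B w w)" "g \<in> ?H" "h = mirror w \<circ> g" by blast
    let ?c = "B w w"
    have wV: "w \<in> V" using w W by blast
    have N: "unit_vecs W \<subseteq> unit_vecs V" using W by (auto simp: unit_vecs_def)
    have gV: "g \<in> gen (mirror ` unit_vecs V)" by (rule subsetD[OF gen_mono[OF image_mono[OF N]] w(3)])
    have NV: "unit_vecs V \<subseteq> V" by (auto simp: unit_vecs_def)
    have "spin V ?c (mirror w \<circ> g) = spin V ?c (mirror w) * spin V ?c g"
        by (rule spin_comp[OF V nonsq_nz[OF w(2)] isom_gen_mirror[OF gV]
            gen_mirror_maps[OF V(2) NV gV] inj_gen_mirror[OF gV] isom_mirror subsp_mirror[OF V(2) wV]])
    moreover have "spin V ?c (mirror w) = -1"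
      using spin_mirror[OF V nonsq_nz[OF w(2)] wV nonsq_nz[OF w(2)]] by (auto intro: exI[of _ 1])
    ultimately have "spin V ?c h = -1" using spin_gen_unit[OF V w(2) gV] w(4) by simp
    then show ?thesis using spin_gen_unit[OF V w(2) h(1)] by simp
  qed
qed

section \<open>Sets of unit vectors closed under reflections\<close>

text \<open>Models the unit vectors whose mirrors lie in a given group, so that group membership
  becomes a question about vectors.\<close>

definition mirror_closed :: "'a poly set \<Rightarrow> bool" where
  "mirror_closed K \<longleftrightarrow> (\<forall>v\<in>K. B v v = 1 \<and> - v \<in> K) \<and> (\<forall>v\<in>K. \<forall>w\<in>K. mirror v w \<in> K)"

lemma mirror_closedD:
  assumes "mirror_closed K"
  shows "v \<in> K \<Longrightarrow> B v v = 1" "v \<in> K \<Longrightarrow> - v \<in> K" "v \<in> K \<Longrightarrow> w \<in> K \<Longrightarrow> mirror v w \<in> K"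
  using assms by (auto simp: mirror_closed_def)

lemma mirror_unit: "B v v = 1 \<Longrightarrow> mirror v x = x - (2 * B x v) \<cdot> v"
  by (simp add: mirror_def)

text \<open>Here \<open>w - v\<close> is isotropic and orthogonal to \<open>v\<close>. Reflecting
  one point of the progression \<open>p\<close> in the next and negating yields the one after that,
  and the prime field lets the progression reach every \<open>c\<close>.\<close>

lemma mirror_closed_line:
  assumes K: "mirror_closed K" and vw: "v \<in> K" "w \<in> K" "B v w = 1"
  shows "v + c \<cdot> (w - v) \<in> K"
proof -
  note K' = mirror_closedD[OF K]
  define p where "p m = v + of_nat m \<cdot> (w - v)" for m :: nat
  have Bp: "B (p a) (p b) = 1" for a b
    using vw K'(1) by (simp add: p_def sym[of w v] algebra_simps)
  have "p m \<in> K \<and> p (Suc m) \<in> K" for m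
  proof (induction m)
    case 0 then show ?case using vw by (simp add: p_def)
  next
    case (Suc m)
    have "p (Suc (Suc m)) = - mirror (p (Suc m)) (p m)"
      unfolding mirror_unit[OF Bp] Bp by (simp add: p_def poly_eq_iff algebra_simps)
    then show ?case using Suc K'(2,3) by simp
  qed
  then show ?thesis using prime_field[of c] by (auto simp: p_def)
qed

text \<open>The Siegel transformation with parameter \<open>t\<close> is the product of the mirrors
  in \<open>e\<close> and in \<open>e - (t / 2) \<cdot> u\<close>.\<close>

lemma mirror_closed_Siegel:
  assumes K: "mirror_closed K" and u: "B e u = 0" "B u u = 0" "\<And>c. e + c \<cdot> u \<in> K" and x: "x \<in> K"
  shows "x + (t * B x u) \<cdot> e - (t * B x e + t * t / 2 * B x u) \<cdot> u \<in> K"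
proof -
  note K' = mirror_closedD[OF K]
  have e: "e \<in> K" "B e e = 1" using u(3)[of 0] K'(1) by simp_all
  let ?f = "e + (- t / 2) \<cdot> u"
  have "mirror ?f (mirror e x) = x + (t * B x u) \<cdot> e - (t * B x e + t * t / 2 * B x u) \<cdot> u"
  proof -
    have 1: "B ?f ?f = 1" by (rule K'(1)[OF u(3)])
    have 2: "B (mirror e x) ?f = - B x e - t / 2 * B x u"
      using e u by (simp add: mirror_unit algebra_simps)
    show ?thesis unfolding mirror_unit[OF 1] 2
      using e by (simp add: mirror_unit poly_eq_iff algebra_simps)
  qed
  moreover have "mirror ?f (mirror e x) \<in> K" by (intro K'(3) u(3) e x)
  ultimately show ?thesis by simp
qed

text \<open>Vectors are sorted by their coefficient of \<open>z\<close>. Siegel transformations act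
  transitively on the unit vectors of a given nonzero level, so one member of \<open>K\<close> per
  level suffices (\<open>A_I\<close>). A reflection leads from level \<open>j\<close> to
  \<open>j + 2\<close>; the odd numbers run through the whole prime field.\<close>

lemma mirror_closed_triple_orth:
  assumes K: "mirror_closed K" and u: "B e u = 0" "B u u = 0" "\<And>c. e + c \<cdot> u \<in> K"
    and z: "z \<in> K" "B z u \<noteq> 0" "B z e = 0"
    and v: "B (al \<cdot> z + be \<cdot> e + ga \<cdot> u) (al \<cdot> z + be \<cdot> e + ga \<cdot> u) = 1"
  shows "al \<cdot> z + be \<cdot> e + ga \<cdot> u \<in> K"
proof -
  note K' = mirror_closedD[OF K]
  define s where "s = B z u"
  have e: "e \<in> K" "B e e = 1" using u(3)[of 0] K'(1) by simp_all
  have s: "s \<noteq> 0" "B z u = s" "B u z = s" using z(2) by (simp_all add: s_def sym[of u z])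
  have Bs: "B z z = 1" "B e z = 0" "B u e = 0" using K'(1) z u by (simp_all add: sym[of e z] sym[of u e])
  note Bs = Bs s(2,3) e(2) z(3) u(1,2)
  define x where "x a b c = a \<cdot> z + b \<cdot> e + c \<cdot> u" for a b c
  have nx: "B (x a b c) (x a b c) = a * a + b * b + 2 * a * c * s" for a b c
    by (simp add: x_def Bs algebra_simps)
  define A where "A a \<longleftrightarrow> (\<forall>b c. B (x a b c) (x a b c) = 1 \<longrightarrow> x a b c \<in> K)" for a
  have A_I: "A a" if a: "a \<noteq> 0" and bc: "x a b c \<in> K" for a b c
    unfolding A_def
  proof (intro allI impI)
    fix b' c' assume n': "B (x a b' c') (x a b' c') = 1"
    \<comment> \<open>This parameter takes the coefficient \<open>b\<close> to \<open>b'\<close>;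
      equality of lengths then forces the coefficient of \<open>u\<close> to become
      \<open>c'\<close>.\<close>
    define t where "t = (b' - b) / (a * s)"
    have t: "t * (a * s) = b' - b" using a s by (simp add: t_def)
    have n: "B (x a b c) (x a b c) = 1" by (rule K'(1)[OF bc])
    have xs: "B (x a b c) u = a * s" "B (x a b c) e = b" by (simp_all add: x_def Bs)
    have "a * s * (c - (t * b + t * t / 2 * (a * s))) = a * s * c'"
    proof -
      define h where "h = t * t / 2"
      have h: "2 * h = t * t" by (simp add: h_def)
      have "2 * (a * s * (c - (t * b + h * (a * s)))) = 2 * (a * s * c')"
        using n[unfolded nx] n'[unfolded nx] h t by Groebner_Basis.algebra
      then have "2 * (a * s * (c - (t * b + t * t / 2 * (a * s)))) = 2 * (a * s * c')"
        unfolding h_def .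
      then show ?thesis by (metis mult_cancel_left two)
    qed
    then have c': "c - (t * b + t * t / 2 * (a * s)) = c'" using a s by simp
    have "x a b c + (t * (a * s)) \<cdot> e - (t * b + t * t / 2 * (a * s)) \<cdot> u \<in> K"
      using mirror_closed_Siegel[OF K u bc, of t] unfolding xs .
    moreover have "x a b c + (t * (a * s)) \<cdot> e - (t * b + t * t / 2 * (a * s)) \<cdot> u = x a b' c'"
      unfolding t c'[symmetric] x_def by (simp add: poly_eq_iff algebra_simps)
    ultimately show "x a b' c' \<in> K" by simp
  qed
  have A1: "A 1" by (rule A_I[of 1 0 0]) (simp_all add: x_def z)
  have Am: "A (- j)" if "A j" for j
    unfolding A_def
  proof (intro allI impI)
    fix b c assume n: "B (x (- j) b c) (x (- j) b c) = 1"
    have "x (- j) b c = - x j (- b) (- c)" by (simp add: x_def)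
    then show "x (- j) b c \<in> K" using that n K'(2) unfolding A_def by fastforce
  qed
  have A2: "A (j + 2)" if j: "A j" "j \<noteq> 0" "j + 2 \<noteq> 0" for j
  proof -
    \<comment> \<open>Chosen so that \<open>2 * B y v = - 2\<close>: reflecting \<open>y\<close> in
      \<open>v\<close>, which has level 1, raises the level by 2.\<close>
    define b where "b = (j + 1) / j"
    define v where "v = x 1 b (- (b * b) / (2 * s))"
    define y where "y = x j 0 ((1 - j * j) / (2 * j * s))"
    have v1: "B v v = 1" unfolding v_def nx using s by simp
    have y1: "B y y = 1" unfolding y_def nx using s j by simp
    have vK: "v \<in> K" using A1 v1 unfolding A_def v_def by blast
    have yK: "y \<in> K" using j(1) y1 unfolding A_def y_def by blast
    define q where "q = 2 * B y v"
    have "j * (j - q) = j * (j + 2)"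
    proof -
      have jb: "j * b = j + 1" using j by (simp add: b_def)
      have "j * q = j * (2 * j) - (j * b) * (j * b) + (1 - j * j)"
        using s j by (simp add: q_def y_def v_def x_def Bs algebra_simps) (simp add: field_simps)
      then show ?thesis unfolding jb by (simp add: algebra_simps)
    qed
    then have q: "j - q = j + 2" using j(2) by simp
    have "mirror v y \<in> K" by (rule K'(3)[OF vK yK])
    moreover have "mirror v y = x (j - q) (- q * b) ((1 - j * j) / (2 * j * s) + q * (b * b) / (2 * s))"
      unfolding mirror_unit[OF v1] q_def[symmetric] by (simp add: y_def v_def x_def poly_eq_iff algebra_simps)
    ultimately show ?thesis using A_I[OF j(3)] unfolding q by metis
  qed
  have odd: "(of_nat (2 * m + 1) = (0::'a) \<or> A (of_nat (2 * m + 1)))" for m :: nat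
  proof (induction m rule: less_induct)
    case (less m)
    show ?case
    proof (cases m)
      case 0 then show ?thesis using A1 by simp
    next
      case (Suc k)
      have ks: "of_nat (2 * m + 1) = (of_nat (2 * k + 1) + 2 :: 'a)" by (simp add: Suc algebra_simps)
      show ?thesis
      proof (cases "of_nat (2 * k + 1) = (0::'a)")
        case False
        then show ?thesis using A2 less.IH[of k] Suc unfolding ks by fastforce
      next
        \<comment> \<open>Level 0 cannot be used for the next step. The odd number before it is -2,
          and negation passes from level -2 to level 2.\<close>
        case True
        then obtain i where i: "k = Suc i" by (cases k) auto
        have ik: "of_nat (2 * i + 1) = (of_nat (2 * k + 1) - 2 :: 'a)" by (simp add: i)
        have i2: "of_nat (2 * i + 1) = (- 2 :: 'a)" unfolding ik True by simp
        have "A (- 2)" using less.IH[of i] i Suc unfolding i2 by simp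
        then show ?thesis unfolding ks True using Am by fastforce
      qed
    qed
  qed
  have "A al" if "al \<noteq> 0"
  proof -
    obtain m where "(al - 1) / 2 = of_nat m" using prime_field by blast
    then have "al = of_nat (2 * m + 1)" by (simp add: field_simps)
    then show ?thesis using odd[of m] that by metis
  qed
  moreover have "x 0 be ga \<in> K" if "B (x 0 be ga) (x 0 be ga) = 1"
  proof -
    have "be * be = 1" using that unfolding nx by simp
    then have "be = 1 \<or> be = -1" using square_eq_1_iff by blast
    then have "x 0 be ga = e + ga \<cdot> u \<or> x 0 be ga = - (e + (- ga) \<cdot> u)" by (auto simp: x_def)
    then show ?thesis using u(3) K'(2) by metis
  qed
  ultimately show ?thesis using v unfolding A_def x_def[symmetric] by metis
qed

text \<open>A Siegel transformation first makes \<open>z\<close> orthogonal to \<open>e\<close>,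
  which its parameter \<open>- B z e / B z u\<close> achieves.\<close>

lemma mirror_closed_triple:
  assumes K: "mirror_closed K" and u: "B e u = 0" "B u u = 0" "\<And>c. e + c \<cdot> u \<in> K"
    and z: "z \<in> K" "B z u \<noteq> 0"
    and v: "B (al \<cdot> z + be \<cdot> e + ga \<cdot> u) (al \<cdot> z + be \<cdot> e + ga \<cdot> u) = 1"
  shows "al \<cdot> z + be \<cdot> e + ga \<cdot> u \<in> K"
proof -
  define t where "t = - B z e / B z u"
  define c where "c = t * B z e + t * t / 2 * B z u"
  define z' where "z' = z + (t * B z u) \<cdot> e - c \<cdot> u"
  have e: "e \<in> K" "B e e = 1" using u(3)[of 0] mirror_closedD(1)[OF K] by simp_all
  have tz: "t * B z u = - B z e" using z by (simp add: t_def)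
  have "z' \<in> K" unfolding z'_def c_def by (rule mirror_closed_Siegel[OF K u z(1)])
  moreover have "B z' u = B z u" "B z' e = 0" using u e by (simp_all add: z'_def tz sym[of u e])
  moreover have eq: "al \<cdot> z + be \<cdot> e + ga \<cdot> u = al \<cdot> z' + (be + al * B z e) \<cdot> e + (ga + al * c) \<cdot> u"
    unfolding z'_def tz by (simp add: poly_eq_iff algebra_simps)
  ultimately show ?thesis
    using mirror_closed_triple_orth[OF K u, of z' al "be + al * B z e" "ga + al * c"] z(2) v
    unfolding eq by simp
qed

text \<open>Once the line \<open>b + c \<cdot> u\<close> lies in \<open>K\<close>, Siegel
  transformations along it carry unit vectors of \<open>U\<close> to all unit vectors of the larger
  space that are not orthogonal to \<open>u\<close>. The orthogonal ones need one more
  reflection.\<close>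

lemma mirror_closed_extend:
  assumes K: "mirror_closed K" and U: "subsp U" "unit_vecs U \<subseteq> K" and u: "u \<in> U" "B u u = 0"
    and b: "b \<in> K" "B b u = 0" and w: "w \<in> U" "B w w = 1" "B w b = 1" "B w u \<noteq> 0"
    and three: "(3::'a) \<noteq> 0" and x: "x \<in> U" and v: "B (x + a \<cdot> b) (x + a \<cdot> b) = 1"
  shows "x + a \<cdot> b \<in> K"
proof -
  note K' = mirror_closedD[OF K] and U' = subspD[OF U(1)]
  define s where "s = B w u"
  have UK: "y \<in> K" if "y \<in> U" "B y y = 1" for y using U(2) that by (auto simp: unit_vecs_def)
  have s: "s \<noteq> 0" "B w u = s" "B u w = s" using w by (simp_all add: s_def sym[of u w])
  note Bs = s(2,3) u(2) b(2) w(2,3)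
  have Bs': "B b b = 1" "B u b = 0" "B b w = 1" using K'(1)[OF b(1)] b(2) w(3) by (simp_all add: sym[of u b] sym[of b w])
  \<comment> \<open>Makes \<open>2 \<cdot> w + g \<cdot> u\<close> a unit vector, as
    \<open>4 + 4 * (g * s) = 1\<close>. Because \<open>g \<noteq> 0\<close>, this vector,
    \<open>b\<close> and the isotropic \<open>w - b\<close> span \<open>u\<close>, and
    \<open>mirror_closed_triple\<close> applies to them.\<close>
  define g where "g = - 3 / (4 * s)"
  have g: "g \<noteq> 0" "4 * (g * s) = - 3" using s three by (simp_all add: g_def)
  have bK: "b + c \<cdot> u \<in> K" for c
  proof -
    define z where "z = 2 \<cdot> w + g \<cdot> u"
    have "B z z = 4 + 4 * (g * s)" by (simp add: z_def Bs Bs' algebra_simps)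
    then have zK: "z \<in> K" using UK[of z] w u U' by (simp add: z_def g(2))
    have l: "b + d \<cdot> (w - b) \<in> K" for d
      by (rule mirror_closed_line[OF K b(1) UK[OF w(1,2)] Bs'(3)])
    have eq: "(c / g) \<cdot> z + (1 - 2 * c / g) \<cdot> b + (- 2 * c / g) \<cdot> (w - b) = b + c \<cdot> u"
      using g by (simp add: z_def poly_eq_iff field_simps)
    have "B (b + c \<cdot> u) (b + c \<cdot> u) = 1" by (simp add: Bs Bs')
    then have "(c / g) \<cdot> z + (1 - 2 * c / g) \<cdot> b + (- 2 * c / g) \<cdot> (w - b) \<in> K"
      using g s by (intro mirror_closed_triple[OF K _ _ l zK])
        (simp_all only: eq, simp_all add: z_def Bs Bs' algebra_simps)
    then show ?thesis unfolding eq .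
  qed
  have first: "y + c \<cdot> b \<in> K"
    if y: "y \<in> U" "B y u \<noteq> 0" "B (y + c \<cdot> b) (y + c \<cdot> b) = 1" for y c
  proof -
    \<comment> \<open>The Siegel parameter that creates the coefficient \<open>c\<close> of
      \<open>b\<close>; the transformation also subtracts \<open>k \<cdot> u\<close>, which is added
      to \<open>y\<close> beforehand.\<close>
    define t where "t = c / B y u"
    define k where "k = t * B y b + t * t / 2 * B y u"
    have t: "t * B y u = c" using y by (simp add: t_def)
    have uy: "B u y = B y u" "B b y = B y b" by (simp_all add: sym)
    define y' where "y' = y + k \<cdot> u"
    have "B y' y' = B y y + 2 * k * B y u" by (simp add: y'_def uy Bs algebra_simps)
    also have "2 * k * B y u = 2 * (t * B y u) * B y b + (t * B y u) * (t * B y u)"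
      by (simp add: k_def algebra_simps)
    also have "B y y + \<dots> = B (y + c \<cdot> b) (y + c \<cdot> b)"
      unfolding t by (simp add: uy Bs' algebra_simps)
    finally have "B y' y' = 1" using y(3) by (simp only:)
    moreover have "y' \<in> U" using y u U' by (simp add: y'_def)
    ultimately have "y' \<in> K" by (intro UK)
    then have "y' + (t * B y' u) \<cdot> b - (t * B y' b + t * t / 2 * B y' u) \<cdot> u \<in> K"
      by (rule mirror_closed_Siegel[OF K b(2) u(2) bK])
    moreover have "B y' u = B y u" "B y' b = B y b" by (simp_all add: y'_def Bs Bs')
    ultimately have "y' + c \<cdot> b - k \<cdot> u \<in> K" by (simp add: t k_def)
    then show ?thesis by (simp add: y'_def)
  qed
  show ?thesis
  proof (cases "B x u = 0")
    case False
    then show ?thesis using first x v by blast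
  next
    case True
    define v' where "v' = x + a \<cdot> b"
    have v': "B v' v' = 1" "B v' u = 0" "B u v' = 0"
      using v True by (simp_all add: v'_def Bs Bs' sym[of u x])
    \<comment> \<open>\<open>t\<close> achieves \<open>B v' z = 1\<close> and \<open>f\<close> then
      \<open>B z z = 1\<close>. Both \<open>z\<close> and
      \<open>mirror z v' = v' - 2 \<cdot> z\<close> have nonzero product with \<open>u\<close>,
      namely \<open>s\<close> and \<open>- 2 * s\<close>, so \<open>first\<close> covers them, and
      reflecting back recovers \<open>v'\<close>.\<close>
    define t where "t = 1 - B w v'"
    define f where "f = - (2 * t * B w v' + t * t) / (2 * s)"
    have f: "2 * (f * s) = - (2 * t * B w v' + t * t)" using s by (simp add: f_def)
    define z where "z = w + t \<cdot> v' + f \<cdot> u"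
    have z: "z = (w + t \<cdot> x + f \<cdot> u) + (t * a) \<cdot> b"
      by (simp add: z_def v'_def poly_eq_iff algebra_simps)
    have zz: "B z z = 1"
    proof -
      have "B z z = 1 + (2 * t * B w v' + t * t) + 2 * (f * s)"
        by (simp add: z_def Bs v' sym[of v' w] algebra_simps)
      then show ?thesis unfolding f by simp
    qed
    have zu: "B z u = s" and zv: "B v' z = 1" using v' by (simp_all add: z_def Bs sym[of v' w] t_def)
    have zK: "z \<in> K" unfolding z
      by (rule first) (use zz zu w x u U' in \<open>simp_all flip: z\<close>, simp add: Bs True s)
    define m where "m = mirror z v'"
    have m: "m = (x - 2 \<cdot> (w + t \<cdot> x + f \<cdot> u)) + (a - 2 * (t * a)) \<cdot> b"
      unfolding m_def mirror_unit[OF zz] zv unfolding z v'_def by (simp add: poly_eq_iff algebra_simps)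
    have mm: "B m m = 1" unfolding m_def by (simp add: isomD(3)[OF isom_mirror] v')
    have "m \<in> K" unfolding m
      by (rule first) (use mm w x u U' s in \<open>simp_all flip: m\<close>, simp add: Bs True)
    then have "mirror z m \<in> K" using zK K'(3) by blast
    then show ?thesis by (simp add: m_def mirror_mirror v'_def)
  qed
qed

end

section \<open>String groups\<close>

abbreviation bvec :: "nat \<Rightarrow> 'a::comm_semiring_1 poly" where
  "bvec i \<equiv> monom 1 i"

text \<open>\<open>edge_type\<close> encodes that the periods \<infinity> come last: as soon as some
  edge up to \<open>i\<close> does not behave like a period 3, edge \<open>i\<close> itself has
  product -1 and the characteristic is not 3.\<close>

locale string_form = prime_form B for B :: "'a::field poly \<Rightarrow> 'a poly \<Rightarrow> 'a" +
  fixes n :: nat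
  assumes unit: "i < n \<Longrightarrow> B (bvec i) (bvec i) = 1"
    and edge: "i + 1 < n \<Longrightarrow> B (bvec i) (bvec (i + 1)) \<noteq> 0"
    and far: "i + 2 \<le> j \<Longrightarrow> B (bvec i) (bvec j) = 0"
    and outside: "n \<le> j \<Longrightarrow> B x (bvec j) = 0"
    and edge_type: "i + 1 < n \<Longrightarrow>
      (\<forall>j\<le>i. (2 * B (bvec j) (bvec (j + 1)))\<^sup>2 = 1) \<or> ((3::'a) \<noteq> 0 \<and> B (bvec i) (bvec (i + 1)) = - 1)"
begin

abbreviation R :: "nat \<Rightarrow> 'a poly \<Rightarrow> 'a poly" where "R i \<equiv> mirror (bvec i)"

abbreviation G :: "nat set \<Rightarrow> ('a poly \<Rightarrow> 'a poly) set" where "G A \<equiv> gen (R ` A)"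

lemma bvec_supp_in [simp]: "i \<in> A \<Longrightarrow> bvec i \<in> supp_in A"
  by (auto simp: supp_in_def)

lemma far': "j + 2 \<le> i \<Longrightarrow> B (bvec i) (bvec j) = 0"
  using far[of j i] by (simp add: sym[of "bvec i"])

section \<open>Radicals of intervals\<close>

lemma form_lowest:
  assumes "\<And>m. m < k \<Longrightarrow> coeff x m = 0" "0 < k"
  shows "B x (bvec (k - 1)) = coeff x k * B (bvec k) (bvec (k - 1))"
proof -
  have "x = (\<Sum>i\<le>degree x. coeff x i \<cdot> bvec i)"
    by (simp add: smult_monom poly_as_sum_of_monoms)
  then have "B x (bvec (k - 1)) = (\<Sum>i\<le>degree x. coeff x i * B (bvec i) (bvec (k - 1)))"
    by (metis (no_types, lifting) sum_left smul_left sum.cong)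
  also have "\<dots> = (\<Sum>i\<in>{k} \<inter> {..degree x}. coeff x i * B (bvec i) (bvec (k - 1)))"
  proof (rule sum.mono_neutral_right)
    show "\<forall>i\<in>{..degree x} - {k} \<inter> {..degree x}. coeff x i * B (bvec i) (bvec (k - 1)) = 0"
    proof
      fix i assume "i \<in> {..degree x} - {k} \<inter> {..degree x}"
      then have "i < k \<or> k - 1 + 2 \<le> i" using assms(2) by auto
      then show "coeff x i * B (bvec i) (bvec (k - 1)) = 0" using assms(1) far' by auto
    qed
  qed auto
  also have "\<dots> = coeff x k * B (bvec k) (bvec (k - 1))"
    by (cases "k \<le> degree x") (auto simp: coeff_eq_0)
  finally show ?thesis .
qed

text \<open>Tridiagonality makes the lowest coefficient of a vector visible to the preceding basis vector, so
  a radical vector is determined by its first coordinate.\<close>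

lemma ex_nonorthogonal:
  assumes x: "x \<in> supp_in {i..<j}" "x \<noteq> 0" "j \<le> n" and i: "0 < i \<or> coeff x i = 0"
  shows "\<exists>k\<ge>i. 0 < k \<and> k < j \<and> B x (bvec (k - 1)) \<noteq> 0 \<and> (coeff x i = 0 \<longrightarrow> i < k)"
proof -
  define k where "k = (LEAST m. coeff x m \<noteq> 0)"
  have ex: "\<exists>m. coeff x m \<noteq> 0" using x(2) by (auto simp: poly_eq_iff)
  have k: "coeff x k \<noteq> 0" unfolding k_def by (rule LeastI_ex[OF ex])
  have low: "coeff x m = 0" if "m < k" for m using not_less_Least that unfolding k_def by blast
  have kij: "i \<le> k" "k < j" using x(1) k by (auto simp: supp_in_def)
  have k0: "0 < k" using i kij k by (cases "k = 0") auto
  have "B (bvec k) (bvec (k - 1)) \<noteq> 0"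
    using edge[of "k - 1"] k0 kij x(3) by (simp add: sym)
  then have "B x (bvec (k - 1)) \<noteq> 0" using form_lowest[OF low k0] k by simp
  moreover have "coeff x i = 0 \<longrightarrow> i < k" using k kij by (cases "i = k") auto
  ultimately show ?thesis using kij k0 by blast
qed

lemma interval_radical:
  assumes "j \<le> n" "x \<in> supp_in {i..<j}" "y \<in> supp_in {i..<j}" "x \<noteq> 0"
    and "\<forall>z\<in>supp_in {i..<j}. B x z = 0" "\<forall>z\<in>supp_in {i..<j}. B y z = 0"
  shows "\<exists>c. y = c \<cdot> x"
proof -
  have zero: "z = 0"
    if zr: "z \<in> supp_in {i..<j}" "coeff z i = 0" "\<forall>w\<in>supp_in {i..<j}. B z w = 0" for z
  proof (rule ccontr)
    assume "z \<noteq> 0"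
    then obtain k where "k < j" "B z (bvec (k - 1)) \<noteq> 0" "i < k"
      using ex_nonorthogonal[OF zr(1) _ assms(1)] zr(2) by blast
    moreover from this have "bvec (k - 1) \<in> supp_in {i..<j}" by (intro bvec_supp_in) auto
    ultimately show False using zr(3) by blast
  qed
  have x0: "coeff x i \<noteq> 0" using zero assms(2,4,5) by blast
  have S: "subsp (supp_in {i..<j} :: 'a poly set)" by simp
  define z where "z = y - (coeff y i / coeff x i) \<cdot> x"
  have "z = 0"
  proof (rule zero)
    show "z \<in> supp_in {i..<j}" unfolding z_def using subspD[OF S] assms(2,3) by blast
    show "coeff z i = 0" using x0 by (simp add: z_def)
    show "\<forall>w\<in>supp_in {i..<j}. B z w = 0" using assms(5,6) by (simp add: z_def)
  qed
  then have "y = (coeff y i / coeff x i) \<cdot> x" by (simp add: z_def)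
  then show ?thesis by blast
qed

text \<open>As \<open>0 < i\<close>, the basis vector \<open>i - 1\<close> outside the interval
  tests the first coordinate as well.\<close>

lemma interval_radical_global:
  assumes "j \<le> n" "0 < i" "x \<in> supp_in {i..<j}" "\<forall>z. B x z = 0"
  shows "x = 0"
  using ex_nonorthogonal[OF assms(3) _ assms(1)] assms(2,4) by blast

section \<open>Displacements under parabolic subgroups\<close>

lemma G_moves:
  assumes "h \<in> G A" shows "h x - x \<in> supp_in A"
  using assms
proof induction
  case gen_id show ?case by (simp add: supp_in_def)
next
  case (gen_step s g)
  then obtain i where i: "i \<in> A" "s = R i" by blast
  have "(s \<circ> g) x - x = (g x - x) - (2 * B (g x) (bvec i) / B (bvec i) (bvec i)) \<cdot> bvec i"
    by (simp add: i mirror_def)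
  also have "\<dots> \<in> supp_in A"
    by (intro subspD[OF subsp_supp_in] gen_step.IH bvec_supp_in i)
  finally show ?case .
qed

lemma G_mono: "A \<subseteq> A' \<Longrightarrow> G A \<subseteq> G A'"
  by (intro gen_mono image_mono)

lemma G_R: "i \<in> A \<Longrightarrow> R i \<in> G A"
  by (intro gen_base imageI)

lemma G_unit_vecs:
  assumes "A \<subseteq> {..<n}" shows "G A \<subseteq> gen (mirror ` unit_vecs (supp_in {..<n}))"
  using assms unit by (intro gen_mono) (auto simp: unit_vecs_def)

lemma G_surj:
  assumes "h \<in> G A" obtains y where "h y = x"
proof -
  have "R ` A = mirror ` bvec ` A" by (simp add: image_image)
  then obtain g where "h \<circ> g = id" using gen_mirror_inverse assms by metis
  then have "h (g x) = x" by (metis comp_apply id_apply)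
  then show thesis using that by blast
qed

lemma G_inverse:
  assumes "h \<in> G A" obtains g where "g \<in> G A" "g \<circ> h = id"
proof -
  have "R ` A = mirror ` bvec ` A" by (simp add: image_image)
  then show thesis using gen_mirror_inverse assms that by metis
qed

subsection \<open>Type A strings\<close>

text \<open>As in the symmetric group, these products represent the cosets of the subgroup without the
  generator \<open>a\<close>.\<close>

fun desc :: "nat \<Rightarrow> nat \<Rightarrow> 'a poly \<Rightarrow> 'a poly" where
  "desc a 0 = id"
| "desc a (Suc k) = R (a + k) \<circ> desc a k"

lemma desc_commute: "k < d \<Longrightarrow> R (a + d) \<circ> desc a k = desc a k \<circ> R (a + d)"
proof (induction k)
  case (Suc k)
  have c: "R (a + d) \<circ> R (a + k) = R (a + k) \<circ> R (a + d)"
    by (rule mirror_commute, rule far') (use Suc.prems in simp)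
  have "R (a + d) \<circ> desc a (Suc k) = (R (a + d) \<circ> R (a + k)) \<circ> desc a k"
    by (simp only: desc.simps comp_assoc)
  also have "\<dots> = R (a + k) \<circ> (R (a + d) \<circ> desc a k)" by (simp only: c comp_assoc)
  also have "R (a + d) \<circ> desc a k = desc a k \<circ> R (a + d)"
    by (rule Suc.IH) (use Suc.prems in simp)
  finally show ?case by (simp only: desc.simps comp_assoc)
qed simp

lemma desc_shift:
  assumes sph: "\<And>j. a \<le> j \<Longrightarrow> j + 1 < e \<Longrightarrow> (2 * B (bvec j) (bvec (j + 1)))\<^sup>2 = 1"
    and e: "e \<le> n" and k: "d + 2 \<le> k" "a + k \<le> e"
  shows "R (a + d) \<circ> desc a k = desc a k \<circ> R (a + d + 1)"
  using k
proof (induction k rule: dec_induct)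
  case base
  have br: "R (a + d) \<circ> (R (a + d + 1) \<circ> R (a + d)) = R (a + d + 1) \<circ> (R (a + d) \<circ> R (a + d + 1))"
    using base e by (intro mirror_braid unit sph) simp_all
  have "R (a + d) \<circ> desc a (d + 2) = (R (a + d) \<circ> (R (a + d + 1) \<circ> R (a + d))) \<circ> desc a d"
    by (simp add: comp_assoc)
  also have "\<dots> = R (a + d + 1) \<circ> (R (a + d) \<circ> (R (a + (d + 1)) \<circ> desc a d))"
    unfolding br by (simp only: comp_assoc add.assoc)
  also have "\<dots> = R (a + d + 1) \<circ> (R (a + d) \<circ> (desc a d \<circ> R (a + (d + 1))))"
    by (simp only: desc_commute[of d "d + 1"] less_add_one)
  also have "\<dots> = desc a (d + 2) \<circ> R (a + d + 1)" by (simp add: comp_assoc)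
  finally show ?case .
next
  case (step k)
  have c: "R (a + d) \<circ> R (a + k) = R (a + k) \<circ> R (a + d)"
    by (rule mirror_commute, rule far) (use step.hyps in simp)
  have "R (a + d) \<circ> desc a (Suc k) = (R (a + d) \<circ> R (a + k)) \<circ> desc a k"
    by (simp only: desc.simps comp_assoc)
  also have "\<dots> = R (a + k) \<circ> (R (a + d) \<circ> desc a k)" by (simp only: c comp_assoc)
  also have "R (a + d) \<circ> desc a k = desc a k \<circ> R (a + d + 1)"
    by (rule step.IH) (use step.prems in simp)
  finally show ?case by (simp only: desc.simps comp_assoc)
qed

text \<open>A generator multiplied onto \<open>desc a k\<close> lengthens it, shortens it, or passes
  to its right, unchanged or with its index raised by one; after passing, its index exceeds
  \<open>a\<close>.\<close>

lemma spherical_cosets: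
  assumes sph: "\<And>j. a \<le> j \<Longrightarrow> j + 1 < e \<Longrightarrow> (2 * B (bvec j) (bvec (j + 1)))\<^sup>2 = 1"
    and e: "a < e" "e \<le> n" and h: "h \<in> G {a..<e}"
  shows "\<exists>k. \<exists>g\<in>G {a+1..<e}. a + k \<le> e \<and> h = desc a k \<circ> g"
  using h
proof induction
  case gen_id
  show ?case by (rule exI[of _ 0], rule bexI[of _ id]) (use e gen.gen_id in auto)
next
  case (gen_step s f)
  then obtain k g where kg: "g \<in> G {a+1..<e}" "a + k \<le> e" "f = desc a k \<circ> g" by blast
  obtain d where d: "s = R (a + d)" "a + d < e" using gen_step.hyps(1)
    by (auto simp: image_iff) (metis le_add_diff_inverse)
  consider "d = k" | "d + 1 = k" | "k < d" | "d + 2 \<le> k" by linarith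
  then show ?case
  proof cases
    case 1
    then have "s \<circ> f = desc a (Suc k) \<circ> g" by (simp only: d kg(3) desc.simps comp_assoc)
    then show ?thesis using kg(1) d(2) 1 by (intro exI[of _ "Suc k"] bexI[of _ g]) simp_all
  next
    case 2
    then have k: "k = Suc d" by simp
    have "f = R (a + d) \<circ> (desc a d \<circ> g)" by (simp only: kg(3) k desc.simps comp_assoc)
    then have "s \<circ> f = (R (a + d) \<circ> R (a + d)) \<circ> (desc a d \<circ> g)" by (simp only: d comp_assoc)
    then have "s \<circ> f = desc a d \<circ> g" by (simp only: mirror_invol id_comp)
    then show ?thesis using kg(1) d(2) by (intro exI[of _ d] bexI[of _ g]) simp_all
  next
    case 3
    have "s \<circ> f = (R (a + d) \<circ> desc a k) \<circ> g" by (simp only: d kg(3) comp_assoc)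
    then have "s \<circ> f = desc a k \<circ> (R (a + d) \<circ> g)" by (simp only: desc_commute[OF 3] comp_assoc)
    moreover have "R (a + d) \<circ> g \<in> G {a+1..<e}"
      by (intro gen.gen_step kg(1) imageI) (use 3 d in auto)
    ultimately show ?thesis using kg(2) by blast
  next
    case 4
    have "s \<circ> f = (R (a + d) \<circ> desc a k) \<circ> g" by (simp only: d kg(3) comp_assoc)
    then have "s \<circ> f = desc a k \<circ> (R (a + d + 1) \<circ> g)"
      by (simp only: desc_shift[OF sph e(2) 4 kg(2)] comp_assoc)
    moreover have "R (a + d + 1) \<circ> g \<in> G {a+1..<e}"
      by (intro gen.gen_step kg(1) imageI) (use 4 kg d in auto)
    ultimately show ?thesis using kg(2) by blast
  qed
qed

text \<open>\<open>R a\<close> acts first and negates \<open>bvec a\<close>; the later factors add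
  multiples of other basis vectors.\<close>

lemma desc_coeff: "a + k \<le> n \<Longrightarrow> 0 < k \<Longrightarrow> coeff (desc a k (bvec a)) a = - 1"
proof (induction k)
  case (Suc k)
  show ?case
  proof (cases "k = 0")
    case True
    then show ?thesis using Suc.prems unit[of a] by (simp add: mirror_self)
  next
    case False
    then show ?thesis using Suc by (simp add: mirror_def)
  qed
qed simp

text \<open>Elements of \<open>G {a+1..<e}\<close> leave coordinate \<open>a\<close> alone, so a
  nontrivial coset representative would betray itself by the sign in
  \<open>desc_coeff\<close>.\<close>

lemma spherical_stabilizer:
  assumes sph: "\<And>j. a \<le> j \<Longrightarrow> j + 1 < e \<Longrightarrow> (2 * B (bvec j) (bvec (j + 1)))\<^sup>2 = 1"
    and e: "a < e" "e \<le> n" and h: "h \<in> G {a..<e}" "\<And>x. coeff (h x - x) a = 0"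
  shows "h \<in> G {a+1..<e}"
proof -
  obtain k g where kg: "g \<in> G {a+1..<e}" "a + k \<le> e" "h = desc a k \<circ> g"
    using spherical_cosets[OF sph e h(1)] by blast
  have "k = 0"
  proof (rule ccontr)
    assume "k \<noteq> 0"
    then have c: "coeff (desc a k (bvec a)) a = - 1" using desc_coeff kg e by simp
    obtain x where x: "g x = bvec a" by (rule G_surj[OF kg(1)])
    have "coeff (g x - x) a = 0" using G_moves[OF kg(1), of x] by (auto simp: supp_in_def)
    then have "coeff x a = 1" by (simp add: x)
    moreover have "coeff (h x) a = - 1" using c by (simp add: kg(3) x)
    ultimately have "(1::'a) + 1 = 0" using h(2)[of x] by simp
    then show False by simp
  qed
  then show ?thesis using kg by simp
qed

lemma spherical_interval:
  assumes sph: "\<And>j. j + 1 < e \<Longrightarrow> (2 * B (bvec j) (bvec (j + 1)))\<^sup>2 = 1" and e: "e \<le> n"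
    and s: "a \<le> s" "s < e" and h: "h \<in> G {a..<e}" "\<And>x. h x - x \<in> supp_in {s<..}"
  shows "h \<in> G {s+1..<e}"
  using s(1) h(1)
proof (induction a rule: inc_induct)
  case base
  then show ?case
    by (intro spherical_stabilizer sph e s) (use h(2) in \<open>auto simp: supp_in_def\<close>)
next
  case (step a)
  have "h \<in> G {a+1..<e}"
    by (intro spherical_stabilizer sph e step.prems) (use step.hyps s h(2) in \<open>auto simp: supp_in_def\<close>)
  then show ?case using step.IH by simp
qed

subsection \<open>Strings ending in an infinite period\<close>

lemma mirror_closed_group: "mirror_closed {v. B v v = 1 \<and> mirror v \<in> G A}"
proof -
  have "mirror (mirror v w) \<in> G A" if "mirror v \<in> G A" "mirror w \<in> G A" for v w
  proof -
    have "mirror (mirror v w) = mirror v \<circ> (mirror w \<circ> mirror v)"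
      using isom_mirror_comp[OF isom_mirror[of v], of w]
      by (metis comp_assoc comp_id mirror_invol)
    then show ?thesis using gen_comp[OF that(1) gen_comp[OF that(2,1)]] by simp
  qed
  then show ?thesis by (auto simp: mirror_closed_def isomD(3)[OF isom_mirror])
qed

lemma supp_in_insert:
  fixes x :: "'a poly"
  assumes "x \<in> supp_in (insert i A)" "i \<notin> A"
  obtains y c where "y \<in> supp_in A" "x = y + c \<cdot> bvec i"
proof -
  have "x - coeff x i \<cdot> bvec i \<in> supp_in A"
    using assms by (auto simp: supp_in_def)
  moreover have "x = (x - coeff x i \<cdot> bvec i) + coeff x i \<cdot> bvec i" by simp
  ultimately show thesis using that by blast
qed

lemma supp_in_singleton: "x \<in> supp_in {i} \<Longrightarrow> x = coeff x i \<cdot> bvec i" for x :: "'a poly"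
  by (auto simp: supp_in_def poly_eq_iff coeff_monom)

lemma supp_in_pair:
  fixes x :: "'a poly"
  assumes "x \<in> supp_in {i, Suc i}"
  obtains c d where "x = c \<cdot> bvec i + d \<cdot> bvec (Suc i)"
proof -
  obtain y c where y: "y \<in> supp_in {Suc i}" "x = y + c \<cdot> bvec i"
    by (rule supp_in_insert[OF assms]) auto
  then show thesis using that[of c "coeff y (Suc i)"] supp_in_singleton[OF y(1)]
    by (simp add: add.commute)
qed

text \<open>\<open>bvec j\<close> and \<open>- bvec (Suc j)\<close> are unit vectors with product 1
  and difference \<open>\<plusminus> u\<close>, so \<open>mirror_closed_line\<close>
  applies.\<close>

lemma end_line:
  assumes j: "Suc j < n" "B (bvec j) (bvec (Suc j)) = - 1" and A: "j \<in> A" "Suc j \<in> A"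
  defines "u \<equiv> bvec j + bvec (Suc j)"
  shows "B (bvec j) u = 0" "B u u = 0" "bvec j + c \<cdot> u \<in> {v. B v v = 1 \<and> mirror v \<in> G A}"
proof -
  let ?K = "{v. B v v = 1 \<and> mirror v \<in> G A}"
  have b: "B (bvec j) (bvec j) = 1" "B (bvec (Suc j)) (bvec (Suc j)) = 1"
    "B (bvec (Suc j)) (bvec j) = - 1"
    using unit j by (simp_all add: sym[of "bvec (Suc j)" "bvec j"])
  show "B (bvec j) u = 0" "B u u = 0" using b j(2) by (simp_all add: u_def)
  have "bvec j \<in> ?K" "- bvec (Suc j) \<in> ?K" using b G_R A by simp_all
  then have "bvec j + (- c) \<cdot> (- bvec (Suc j) - bvec j) \<in> ?K"
    using j(2) by (intro mirror_closed_line[OF mirror_closed_group]) simp_all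
  then show "bvec j + c \<cdot> u \<in> ?K" by (simp add: u_def algebra_simps smult_diff_right smult_add_right)
qed

text \<open>Basis vectors are added on the left. In the last plane all unit vectors are
  \<open>\<plusminus> (bvec j + c \<cdot> u)\<close>. The next basis vector is not orthogonal to
  \<open>u\<close>, which suits \<open>mirror_closed_triple\<close>; all further ones are, and call
  for \<open>mirror_closed_extend\<close>.\<close>

lemma unit_mirrors_in_group:
  assumes j: "Suc j < n" "B (bvec j) (bvec (Suc j)) = - 1" and three: "(3::'a) \<noteq> 0" and i: "i \<le> j"
  shows "unit_vecs (supp_in {i..Suc j}) \<subseteq> {v. B v v = 1 \<and> mirror v \<in> G {i..Suc j}}"
  using i
proof (induction i rule: inc_induct)
  case base
  let ?K = "{v. B v v = 1 \<and> mirror v \<in> G {j..Suc j}}"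
  show ?case
  proof
    fix x assume "x \<in> unit_vecs (supp_in {j..Suc j})"
    then have x: "x \<in> supp_in {j, Suc j}" "B x x = 1"
      by (auto simp: unit_vecs_def atLeastAtMostSuc_conv insert_commute)
    obtain al be where ab: "x = al \<cdot> bvec j + be \<cdot> bvec (Suc j)"
      using x(1) by (rule supp_in_pair)
    define u where "u = bvec j + (bvec (Suc j) :: 'a poly)"
    note u = end_line[OF j, of "{j..Suc j}", folded u_def]
    have eq: "x = (al - be) \<cdot> bvec j + be \<cdot> u"
      by (simp add: ab u_def smult_diff_left smult_add_right)
    have "B (bvec j) (bvec j) = 1" "B u (bvec j) = 0" using unit j u(1) by (simp_all add: sym[of u "bvec j"])
    then have "(al - be) * (al - be) = 1"
      using x(2) u(1,2) unfolding eq by (simp add: algebra_simps)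
    then have "al - be = 1 \<or> al - be = -1" using square_eq_1_iff by blast
    then have "x = bvec j + be \<cdot> u \<or> x = - (bvec j + (- be) \<cdot> u)"
      unfolding eq by auto
    moreover have l: "bvec j + c \<cdot> u \<in> ?K" for c by (rule u(3)) auto
    moreover have "- (bvec j + (- be) \<cdot> u) \<in> ?K"
      by (rule mirror_closedD(2)[OF mirror_closed_group l])
    ultimately show "x \<in> ?K" by (elim disjE) (simp_all only:)
  qed
next
  case (step i)
  let ?A = "{i..Suc j}"
  let ?U = "supp_in {Suc i..Suc j} :: 'a poly set"
  let ?K = "{v. B v v = 1 \<and> mirror v \<in> G ?A}"
  define u where "u = bvec j + (bvec (Suc j) :: 'a poly)"
  have jA: "j \<in> ?A" "Suc j \<in> ?A" using step.hyps by auto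
  note K = mirror_closed_group[of ?A]
  note u = end_line[OF j jA, folded u_def]
  have UK: "unit_vecs ?U \<subseteq> ?K"
    using step.IH G_mono[of "{Suc i..Suc j}" ?A] by (auto simp: subset_iff)
  have bK: "bvec i \<in> ?K" using unit[of i] step.hyps j G_R[of i ?A] by simp
  show ?case
  proof
    fix x assume "x \<in> unit_vecs (supp_in ?A)"
    then have x: "x \<in> supp_in (insert i {Suc i..Suc j})" "B x x = 1"
      using step.hyps by (auto simp: unit_vecs_def atLeastAtMost_insertL Suc_leI)
    obtain y a where ya: "y \<in> ?U" "x = y + a \<cdot> bvec i"
      by (rule supp_in_insert[OF x(1)]) auto
    have e: "B (bvec i) (bvec (Suc i)) \<noteq> 0" using edge[of i] step.hyps j by simp
    show "x \<in> ?K"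
    proof (cases "Suc i = j")
      case True
      then have "y \<in> supp_in {j, Suc j}"
        using ya(1) by (simp add: atLeastAtMostSuc_conv insert_commute)
      then obtain al be where ab: "y = al \<cdot> bvec j + be \<cdot> bvec (Suc j)" by (rule supp_in_pair)
      have eq: "x = a \<cdot> bvec i + (al - be) \<cdot> bvec j + be \<cdot> u"
        by (simp add: ya(2) ab u_def smult_diff_left smult_add_right)
      have "B (bvec i) u \<noteq> 0" using e True far[of i "Suc j"] by (simp add: u_def)
      then show ?thesis using x(2) unfolding eq by (intro mirror_closed_triple[OF K u bK])
    next
      case False
      then have ij: "Suc i < j" using step.hyps by simp
      define m where "m = 1 / B (bvec (Suc i)) (bvec i)"
      \<comment> \<open>The first summand provides the product 1 with \<open>bvec i\<close>, the
        second a nonzero product with \<open>u\<close>. If \<open>i + 2 = j\<close>, the first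
        summand is a multiple of \<open>bvec (j - 1)\<close> and does both.\<close>
      define w' where "w' = m \<cdot> bvec (Suc i) + (if Suc (Suc i) = j then 0 else bvec (j - 1))"
      have S: "subsp ?U" by simp
      have "j - 1 \<in> {Suc i..Suc j}" using ij by auto
      then have "(if Suc (Suc i) = j then 0 else bvec (j - 1)) \<in> ?U"
        using subspD(1)[OF S] bvec_supp_in by simp
      then have w'U: "w' \<in> ?U" unfolding w'_def using ij by (intro subspD[OF S] bvec_supp_in) auto
      have m: "m \<noteq> 0" "m * B (bvec (Suc i)) (bvec i) = 1" using e by (simp_all add: m_def sym)
      have w'b: "B w' (bvec i) = 1" using m ij by (simp add: w'_def far')
      have bu: "B (bvec i) u = 0" "B u (bvec i) = 0" using ij by (simp_all add: u_def far far')
      have ej: "B (bvec (j - 1)) (bvec j) \<noteq> 0" using edge[of "j - 1"] ij j by simp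
      have w'u: "B w' u \<noteq> 0"
      proof (cases "Suc (Suc i) = j")
        case True
        then show ?thesis using ej m far[of "Suc i" "Suc j"] by (auto simp: w'_def u_def)
      next
        case False
        then show ?thesis using ij ej far[of "Suc i" j] far[of "Suc i" "Suc j"] far[of "j - 1" "Suc j"]
          by (auto simp: w'_def u_def)
      qed
      \<comment> \<open>Adding a multiple of the isotropic \<open>u\<close> adjusts the length of
        \<open>w'\<close> to 1 without disturbing either product.\<close>
      define c where "c = (1 - B w' w') / (2 * B w' u)"
      define w where "w = w' + c \<cdot> u"
      have c: "2 * (c * B w' u) = 1 - B w' w'" using w'u by (simp add: c_def)
      have uU: "u \<in> ?U" unfolding u_def using ij by (intro subspD[OF S] bvec_supp_in) auto
      have "B w w = B w' w' + 2 * (c * B w' u)"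
        using u(2) by (simp add: w_def sym[of u w'] algebra_simps)
      then have ww: "B w w = 1" unfolding c by simp
      show ?thesis unfolding ya(2)
      proof (rule mirror_closed_extend[OF K S UK uU u(2) bK bu(1) _ ww _ _ three ya(1)])
        show "w \<in> ?U" unfolding w_def by (intro subspD[OF S] w'U uU)
        show "B w (bvec i) = 1" using w'b bu by (simp add: w_def)
        show "B w u \<noteq> 0" using w'u u(2) by (simp add: w_def)
        show "B (y + a \<cdot> bvec i) (y + a \<cdot> bvec i) = 1" using x(2) ya(2) by simp
      qed
    qed
  qed
qed

subsection \<open>Intersections of parabolic subgroups\<close>

lemma interval_stabilizer:
  assumes s: "a \<le> s" "s < e" "e \<le> n" and h: "h \<in> G {a..<e}" "\<And>x. h x - x \<in> supp_in {s<..}"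
  shows "h \<in> G {s+1..<e}"
proof (cases "\<forall>j. j + 1 < e \<longrightarrow> (2 * B (bvec j) (bvec (j + 1)))\<^sup>2 = 1")
  case True
  then show ?thesis using spherical_interval[of e a s h] s h by blast
next
  case False
  then obtain j0 where j0: "j0 + 1 < e" "(2 * B (bvec j0) (bvec (j0 + 1)))\<^sup>2 \<noteq> 1" by blast
  \<comment> \<open>The last edge below \<open>e\<close>. The case distinction ranges over all edges
    below \<open>e\<close>, even those left of \<open>a\<close>, so that \<open>edge_type\<close>
    applies to this one.\<close>
  define j where "j = e - 2"
  have je: "e = Suc (Suc j)" "j0 \<le> j" using j0 by (simp_all add: j_def)
  have "(3::'a) \<noteq> 0 \<and> B (bvec j) (bvec (j + 1)) = - 1"
    using edge_type[of j] j0 je s(3) by auto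
  then have three: "(3::'a) \<noteq> 0" and ej: "B (bvec j) (bvec (Suc j)) = - 1" by simp_all
  let ?W = "supp_in {s+1..<e} :: 'a poly set"
  have f: "finite (supp_in {..<n} :: 'a poly set)" using fin by (rule finite_supp_in) simp
  have WV: "?W \<subseteq> supp_in {..<n}" using s by (intro supp_in_mono) auto
  have hW: "h x - x \<in> ?W" for x
  proof -
    have "{s+1..<e} = {a..<e} \<inter> {s<..}" using s by auto
    then show ?thesis using G_moves[OF h(1), of x] h(2)[of x] by (auto simp: supp_in_def)
  qed
  have hV: "h \<in> gen (mirror ` unit_vecs (supp_in {..<n}))"
    using G_unit_vecs[of "{a..<e}"] h(1) s(3) by fastforce
  note rad = interval_radical[OF s(3), of _ "s + 1"]
  note rad' = interval_radical_global[OF s(3), of "s + 1", simplified]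
  show ?thesis
  proof (cases "s + 1 \<le> j")
    case True
    have "h \<in> gen (mirror ` unit_vecs ?W)"
    proof (rule isom_in_unit_mirrors[OF f subsp_supp_in WV subsp_supp_in _ _ three hV hW])
      show "bvec j \<in> ?W" using True je by (intro bvec_supp_in) simp
      show "B (bvec j) (bvec j) = 1" using unit je s(3) by simp
    qed (use rad rad' in auto)
    moreover have "mirror ` unit_vecs ?W \<subseteq> G {s+1..<e}"
      using unit_mirrors_in_group[of j "s + 1"] True je s(3) ej three
      by (auto simp: atLeastLessThanSuc_atLeastAtMost)
    ultimately show ?thesis using gen_subset by blast
  next
    case False
    \<comment> \<open>At most one generator is left, too few for
      \<open>unit_mirrors_in_group\<close>; but every anisotropic vector is then a multiple of that
      basis vector.\<close>
    have "h \<in> gen (mirror ` {v \<in> ?W. B v v \<noteq> 0})"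
      by (rule Cartan_Dieudonne[OF finite_subset[OF WV f] subsp_supp_in isom_gen_mirror[OF hV] hW])
        (use rad rad' in auto)
    moreover have "mirror ` {v \<in> ?W. B v v \<noteq> 0} \<subseteq> G {s+1..<e}"
    proof clarify
      fix v assume v: "v \<in> ?W" "B v v \<noteq> 0"
      have v0: "v \<noteq> 0" using v by auto
      have "{s+1..<e} = {s+1} \<or> {s+1..<e} = {}" using False je s by auto
      then show "mirror v \<in> G {s+1..<e}"
      proof
        assume A: "{s+1..<e} = {s+1}"
        then have "v = coeff v (s+1) \<cdot> bvec (s+1)" using v(1) supp_in_singleton by simp
        moreover from this have "coeff v (s+1) \<noteq> 0" using v0 by auto
        ultimately have "mirror v = R (s+1)" using mirror_smul by metis
        then show ?thesis unfolding A using G_R[of "s+1" "{s+1}"] by simp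
      next
        assume "{s+1..<e} = {}"
        then have "v = 0" using v(1) by (auto simp: supp_in_def poly_eq_iff)
        then show ?thesis using v0 by simp
      qed
    qed
    ultimately show ?thesis using gen_subset by blast
  qed
qed

lemma G_split:
  assumes "t \<notin> A" "h \<in> G A"
  obtains x y where "x \<in> G (A \<inter> {..<t})" "y \<in> G (A \<inter> {t<..})" "h = x \<circ> y"
proof -
  from assms(2) have "\<exists>x\<in>G (A \<inter> {..<t}). \<exists>y\<in>G (A \<inter> {t<..}). h = x \<circ> y"
  proof induction
    case gen_id
    show ?case by (intro bexI[of _ id] gen.gen_id) simp
  next
    case (gen_step s g)
    then obtain i x y where i: "i \<in> A" "s = R i"
      and xy: "x \<in> G (A \<inter> {..<t})" "y \<in> G (A \<inter> {t<..})" "g = x \<circ> y" by blast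
    have "i \<noteq> t" using i assms(1) by auto
    then consider "i < t" | "t < i" by linarith
    then show ?case
    proof cases
      case 1
      have "R i \<circ> x \<in> G (A \<inter> {..<t})" by (intro gen.gen_step imageI xy) (use i 1 in auto)
      moreover have "s \<circ> g = (R i \<circ> x) \<circ> y" by (simp only: i xy comp_assoc)
      ultimately show ?thesis using xy(2) by blast
    next
      case 2
      have "R i \<circ> y \<in> G (A \<inter> {t<..})" by (intro gen.gen_step imageI xy) (use i 2 in auto)
      moreover have "x \<circ> R i = R i \<circ> x"
        using xy(1) by (rule gen_commute) (use 2 in \<open>auto intro!: mirror_commute far\<close>)
      then have "s \<circ> g = x \<circ> (R i \<circ> y)" by (simp only: i xy flip: comp_assoc)
      ultimately show ?thesis using xy(1) by blast
    qed
  qed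
  then show thesis using that by blast
qed

text \<open>The displacement of \<open>x (y v)\<close> is the sum of those caused by
  \<open>x\<close> and by \<open>y\<close>, which occupy disjoint sets of coordinates and therefore
  cannot cancel.\<close>

lemma G_disjoint_moves:
  assumes x: "x \<in> G A" and y: "y \<in> G A'" and xy: "\<And>v. x (y v) - v \<in> supp_in C"
  shows "A \<inter> A' = {} \<Longrightarrow> x v - v \<in> supp_in (A \<inter> C)" "A \<inter> A' = {} \<Longrightarrow> y v - v \<in> supp_in (A' \<inter> C)"
proof -
  have c: "coeff (x (y w) - w) m = coeff (x (y w) - y w) m + coeff (y w - w) m" for w m by simp
  assume d: "A \<inter> A' = {}"
  have xm: "coeff (x w - w) m = 0" if "m \<notin> A" for w m using G_moves[OF x, of w] that by (auto simp: supp_in_def)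
  have ym: "coeff (y w - w) m = 0" if "m \<notin> A'" for w m using G_moves[OF y, of w] that by (auto simp: supp_in_def)
  have z: "coeff (x (y w) - w) m = 0" if "m \<notin> C" for w m using xy[of w] that by (auto simp: supp_in_def)
  show "x v - v \<in> supp_in (A \<inter> C)"
  proof -
    obtain w where w: "y w = v" by (rule G_surj[OF y])
    have "coeff (x v - v) m = 0" if "m \<notin> A \<inter> C" for m
    proof (cases "m \<in> A")
      case True
      then have "m \<notin> A'" "m \<notin> C" using d that by auto
      then show ?thesis using c[of w m] ym[of m w] z[of m w] w by simp
    qed (rule xm)
    then show ?thesis by (simp add: supp_in_def)
  qed
  show "y v - v \<in> supp_in (A' \<inter> C)"
  proof -
    have "coeff (y v - v) m = 0" if "m \<notin> A' \<inter> C" for m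
    proof (cases "m \<in> A'")
      case True
      then have "m \<notin> A" "m \<notin> C" using d that by auto
      then show ?thesis using c[of v m] xm[of m "y v"] z[of m v] by simp
    qed (rule ym)
    then show ?thesis by (simp add: supp_in_def)
  qed
qed

lemma fixed_is_id:
  fixes h :: "'a poly \<Rightarrow> 'a poly"
  assumes "\<And>v. h v - v \<in> supp_in {}" shows "h = id"
proof
  fix v
  have "h v - v = 0" using assms[of v] by (auto simp: supp_in_def intro: poly_eqI)
  then show "h v = id v" by simp
qed

text \<open>The maximal interval \<open>{a..<e}\<close> of \<open>A\<close> around \<open>s\<close>
  is split off. The factor to its left must be trivial because it could only move coordinates below
  \<open>s\<close>, the factor to its right already lies in the desired group, and
  \<open>interval_stabilizer\<close> treats the middle.\<close>

lemma parabolic_stabilizer: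
  assumes A: "A \<subseteq> {..<n}" and h: "h \<in> G A" "\<And>v. h v - v \<in> supp_in {s<..}"
  shows "h \<in> G (A \<inter> {s<..})"
proof (cases "s \<in> A")
  case False
  obtain x y where xy: "x \<in> G (A \<inter> {..<s})" "y \<in> G (A \<inter> {s<..})" "h = x \<circ> y"
    by (rule G_split[OF False h(1)])
  have "x v - v \<in> supp_in (A \<inter> {..<s} \<inter> {s<..})" for v
    by (rule G_disjoint_moves(1)[OF xy(1,2)]) (use h(2) xy(3) in auto)
  moreover have "A \<inter> {..<s} \<inter> {s<..} = {}" by auto
  ultimately have "x = id" by (intro fixed_is_id) simp
  then show ?thesis using xy by simp
next
  case True
  define e where "e = (LEAST e. s < e \<and> e \<notin> A)"
  have ex: "\<exists>e. s < e \<and> e \<notin> A" using A True by (intro exI[of _ n]) auto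
  have e: "s < e" "e \<notin> A" using LeastI_ex[OF ex] by (simp_all add: e_def)
  have mid: "m \<in> A" if "s < m" "m < e" for m using not_less_Least that unfolding e_def by blast
  obtain x y where xy: "x \<in> G (A \<inter> {..<e})" "y \<in> G (A \<inter> {e<..})" "h = x \<circ> y"
    by (rule G_split[OF e(2) h(1)])
  have xs: "x v - v \<in> supp_in (A \<inter> {..<e} \<inter> {s<..})" for v
    by (rule G_disjoint_moves(1)[OF xy(1,2)]) (use h(2) xy(3) in auto)
  define a where "a = (LEAST a. {a..s} \<subseteq> A)"
  have a: "{a..s} \<subseteq> A" unfolding a_def by (rule LeastI[of _ s]) (use True in simp)
  have as: "a \<le> s" unfolding a_def by (rule Least_le) (use True in simp)
  have ae: "{a..<e} \<subseteq> A"
  proof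
    fix m assume "m \<in> {a..<e}"
    then show "m \<in> A" using a mid[of m] by (cases "m \<le> s") auto
  qed
  have en: "e \<le> n"
  proof (rule ccontr)
    assume "\<not> e \<le> n"
    then have "n \<in> A" using mid[of n] A True by auto
    then show False using A by auto
  qed
  have sub: "G {s+1..<e} \<subseteq> G (A \<inter> {s<..})" using ae as by (intro G_mono) auto
  have "x \<in> G {s+1..<e}"
  \<comment> \<open>If \<open>a = 0\<close>, nothing lies to the left and there is no index
    \<open>a - 1\<close> to split at.\<close>
  proof (cases "a = 0")
    case True
    then have "A \<inter> {..<e} = {a..<e}" using ae by auto
    then show ?thesis using xy(1) xs as e(1) en
      by (intro interval_stabilizer[of a]) (auto intro: subsetD[OF supp_in_mono, rotated])
  next
    case False
    define t where "t = a - 1"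
    have t: "a = Suc t" using False by (simp add: t_def)
    have tA: "t \<notin> A"
    proof
      assume "t \<in> A"
      then have "{t..s} \<subseteq> A" using a t by (auto simp: subset_iff) (metis Suc_leI le_neq_implies_less)
      then have "a \<le> t" unfolding a_def by (rule Least_le)
      then show False using t by simp
    qed
    obtain x1 x2 where x12: "x1 \<in> G (A \<inter> {..<e} \<inter> {..<t})" "x2 \<in> G (A \<inter> {..<e} \<inter> {t<..})" "x = x1 \<circ> x2"
      by (rule G_split[OF _ xy(1), of t]) (use tA in auto)
    have x1v: "x1 v - v \<in> supp_in (A \<inter> {..<e} \<inter> {..<t} \<inter> (A \<inter> {..<e} \<inter> {s<..}))"
      and x2v: "x2 v - v \<in> supp_in (A \<inter> {..<e} \<inter> {t<..} \<inter> (A \<inter> {..<e} \<inter> {s<..}))" for v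
      by (rule G_disjoint_moves[OF x12(1,2)]; use xs x12(3) in auto)+
    have "A \<inter> {..<e} \<inter> {..<t} \<inter> (A \<inter> {..<e} \<inter> {s<..}) = {}" using as t by auto
    then have "x1 = id" using x1v by (intro fixed_is_id) simp
    moreover have "A \<inter> {..<e} \<inter> {t<..} = {a..<e}" using ae t by auto
    ultimately show ?thesis using x12 x2v as e(1) en
      by (intro interval_stabilizer[of a]) (auto intro: subsetD[OF supp_in_mono, rotated])
  qed
  moreover have "G (A \<inter> {e<..}) \<subseteq> G (A \<inter> {s<..})" using e by (intro G_mono) auto
  ultimately show ?thesis unfolding xy(3) using sub xy(2) by (intro gen_comp) auto
qed

text \<open>Let \<open>s\<close> be the least index in exactly one of the sets, say in
  \<open>I\<close>. Splitting \<open>h\<close> at \<open>s\<close> inside \<open>G J\<close> leaves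
  a factor below \<open>s\<close>, common to both groups, and a factor moving vectors only above
  \<open>s\<close>. By \<open>parabolic_stabilizer\<close> the latter avoids the generator
  \<open>s\<close>, so \<open>I\<close> shrinks and induction applies.\<close>

lemma parabolic_intersection:
  assumes "I \<subseteq> {..<n}" "J \<subseteq> {..<n}" "h \<in> G I" "h \<in> G J"
  shows "h \<in> G (I \<inter> J)"
  using assms
proof (induction "card I + card J" arbitrary: I J h rule: less_induct)
  case less
  have main: "h \<in> G (I \<inter> J)"
    if IJ: "I \<subseteq> {..<n}" "J \<subseteq> {..<n}" "h \<in> G I" "h \<in> G J"
      and hyp: "\<And>I' J' h. card I' + card J' < card I + card J \<Longrightarrow> I' \<subseteq> {..<n} \<Longrightarrow> J' \<subseteq> {..<n} \<Longrightarrow>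
        h \<in> G I' \<Longrightarrow> h \<in> G J' \<Longrightarrow> h \<in> G (I' \<inter> J')"
      and s: "s \<in> I" "s \<notin> J" "\<And>m. m < s \<Longrightarrow> m \<in> I \<longleftrightarrow> m \<in> J"
    for I J h s
  proof -
    have fI: "finite I" "finite J" using IJ(1,2) by (auto intro: finite_subset)
    obtain x y where xy: "x \<in> G (J \<inter> {..<s})" "y \<in> G (J \<inter> {s<..})" "h = x \<circ> y"
      by (rule G_split[OF s(2) IJ(4)])
    have low: "J \<inter> {..<s} \<subseteq> I \<inter> J" using s(3) by auto
    obtain x' where x': "x' \<in> G (J \<inter> {..<s})" "x' \<circ> x = id" by (rule G_inverse[OF xy(1)])
    have "x' \<in> G I" using x'(1) low G_mono[of "J \<inter> {..<s}" I] by blast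
    then have "x' \<circ> h \<in> G I" using IJ(3) by (rule gen_comp)
    moreover have "x' \<circ> h = y" using x'(2) unfolding xy(3) by (simp flip: comp_assoc)
    ultimately have yI: "y \<in> G I" by simp
    have "y v - v \<in> supp_in {s<..}" for v
      using G_moves[OF xy(2), of v] supp_in_mono[of "J \<inter> {s<..}" "{s<..}"] by blast
    then have "y \<in> G (I \<inter> {s<..})" by (rule parabolic_stabilizer[OF IJ(1) yI])
    moreover have "card (I \<inter> {s<..}) < card I"
      by (rule psubset_card_mono[OF fI(1)]) (use s in auto)
    moreover have "card (J \<inter> {s<..}) \<le> card J" by (rule card_mono[OF fI(2)]) auto
    ultimately have "y \<in> G ((I \<inter> {s<..}) \<inter> (J \<inter> {s<..}))"
      using IJ(1,2) xy(2) by (intro hyp[of "I \<inter> {s<..}" "J \<inter> {s<..}"]) auto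
    then have "y \<in> G (I \<inter> J)" using G_mono[of "(I \<inter> {s<..}) \<inter> (J \<inter> {s<..})" "I \<inter> J"] by blast
    moreover have "x \<in> G (I \<inter> J)" using xy(1) G_mono[OF low] by blast
    ultimately show ?thesis unfolding xy(3) by (rule gen_comp[rotated])
  qed
  show ?case
  proof (cases "I = J")
    case True
    then show ?thesis using less.prems by simp
  next
    case False
    define s where "s = (LEAST m. (m \<in> I) \<noteq> (m \<in> J))"
    have ex: "\<exists>m. (m \<in> I) \<noteq> (m \<in> J)" using False by blast
    have s: "(s \<in> I) \<noteq> (s \<in> J)" unfolding s_def by (rule LeastI_ex[OF ex])
    have low: "m \<in> I \<longleftrightarrow> m \<in> J" if "m < s" for m using not_less_Least that unfolding s_def by blast
    show ?thesis
    proof (cases "s \<in> I")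
      case True
      then show ?thesis using main[OF less.prems, of s] less.hyps s low by blast
    next
      case False
      then have "h \<in> G (J \<inter> I)"
        using main[OF less.prems(2,1,4,3), of s] less.hyps s low by (simp add: add.commute)
      then show ?thesis by (simp add: Int_commute)
    qed
  qed
qed

end

section \<open>Matrices acting on coefficient vectors\<close>

text \<open>A matrix acts on the coefficients below \<open>n\<close>; the remaining ones are left alone, so that the
  generators become the maps \<open>mirror (bvec i)\<close> on all polynomials.\<close>

definition act :: "nat \<Rightarrow> 'a::comm_ring_1 mat \<Rightarrow> 'a poly \<Rightarrow> 'a poly" where
  "act n M x = x + (\<Sum>m<n. monom ((\<Sum>j<n. M $$ (m, j) * coeff x j) - coeff x m) m)"

lemma coeff_act:
  "coeff (act n M x) m = (if m < n then \<Sum>j<n. M $$ (m, j) * coeff x j else coeff x m)"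
  by (auto simp: act_def coeff_sum coeff_monom)

lemma act_mult:
  assumes "M \<in> carrier_mat n n" "N \<in> carrier_mat n n"
  shows "act n (M * N) = act n M \<circ> act n N"
proof (intro ext poly_eqI)
  fix x m
  have "(\<Sum>j<n. (M * N) $$ (m, j) * coeff x j) = (\<Sum>l<n. M $$ (m, l) * (\<Sum>j<n. N $$ (l, j) * coeff x j))"
    if "m < n"
  proof -
    have "(\<Sum>j<n. (M * N) $$ (m, j) * coeff x j) = (\<Sum>j<n. \<Sum>l<n. M $$ (m, l) * N $$ (l, j) * coeff x j)"
      using assms that by (simp add: scalar_prod_def sum_distrib_right atLeast0LessThan)
    also have "\<dots> = (\<Sum>l<n. \<Sum>j<n. M $$ (m, l) * N $$ (l, j) * coeff x j)"
      by (rule sum.swap)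
    finally show ?thesis by (simp add: sum_distrib_left mult.assoc)
  qed
  then show "coeff (act n (M * N) x) m = coeff ((act n M \<circ> act n N) x) m"
    by (simp add: coeff_act)
qed

lemma act_one: "act n (1\<^sub>m n) = id"
proof (intro ext poly_eqI)
  fix x :: "'a poly" and m
  have "(\<Sum>j<n. (1\<^sub>m n :: 'a mat) $$ (m, j) * coeff x j) = (\<Sum>j<n. if j = m then coeff x j else 0)" if "m < n"
    using that by (intro sum.cong) auto
  then show "coeff (act n (1\<^sub>m n) x) m = coeff (id x) m"
    by (simp add: coeff_act)
qed

lemma act_inj:
  assumes "M \<in> carrier_mat n n" "N \<in> carrier_mat n n" "act n M = act n N"
  shows "M = N"
proof (rule eq_matI)
  have e: "coeff (act n P (bvec j)) i = P $$ (i, j)" if "i < n" "j < n" for P :: "'a mat" and i j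
  proof -
    have "(\<Sum>l<n. P $$ (i, l) * coeff (bvec j) l) = (\<Sum>l<n. if l = j then P $$ (i, l) else 0)"
      by (intro sum.cong) auto
    then show ?thesis using that by (simp add: coeff_act)
  qed
  fix i j assume "i < dim_row N" "j < dim_col N"
  then show "M $$ (i, j) = N $$ (i, j)" using e[of i j M] e[of i j N] assms by simp
qed (use assms in auto)

lemma group_GL: "group (GL_group n :: 'a::comm_ring_1 mat monoid)"
proof -
  interpret ring "ring_mat TYPE('a) n ()" by (rule ring_mat)
  show ?thesis unfolding GL_group_def by (rule units_group)
qed

lemma GL_simps:
  "mult (GL_group n) = (*)" "one (GL_group n) = 1\<^sub>m n"
  by (simp_all add: GL_group_def units_of_def ring_mat_simps)

lemma GL_carrier_mat: "M \<in> carrier (GL_group n) \<Longrightarrow> M \<in> carrier_mat n n"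
  by (simp add: GL_group_def units_of_def Units_def ring_mat_simps)

lemma GL_involution:
  "M \<in> carrier_mat n n \<Longrightarrow> M * M = 1\<^sub>m n \<Longrightarrow> M \<in> carrier (GL_group n)"
  by (auto simp: GL_group_def units_of_def Units_def ring_mat_simps)

lemma act_generate:
  fixes r :: "nat \<Rightarrow> 'a::comm_ring_1 mat"
  assumes r: "\<And>i. i \<in> I \<Longrightarrow> r i \<in> carrier_mat n n" "\<And>i. i \<in> I \<Longrightarrow> r i * r i = 1\<^sub>m n"
    and M: "M \<in> generate (GL_group n) (r ` I)"
  shows "act n M \<in> gen ((\<lambda>i. act n (r i)) ` I)"
proof -
  interpret GL: group "GL_group n :: 'a mat monoid" by (rule group_GL)
  have c: "r ` I \<subseteq> carrier (GL_group n)" using r GL_involution by blast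
  show ?thesis using M
  proof induction
    case one
    show ?case by (simp only: GL_simps act_one gen_id)
  next
    case (incl h)
    then show ?case by (auto intro!: gen_base)
  next
    case (inv h)
    then obtain i where i: "i \<in> I" "h = r i" by blast
    have "inv\<^bsub>GL_group n\<^esub> (r i) = r i"
      using r[OF i(1)] c i by (intro GL.inv_equality) (auto simp: GL_simps)
    then show ?case using i by (auto intro!: gen_base)
  next
    case (eng g h)
    have "g \<in> carrier_mat n n" "h \<in> carrier_mat n n"
      using GL.generate_in_carrier[OF c] eng.hyps GL_carrier_mat by blast+
    then have "act n (g \<otimes>\<^bsub>GL_group n\<^esub> h) = act n g \<circ> act n h" by (simp only: GL_simps act_mult)
    then show ?case using gen_comp[OF eng.IH] by (simp only:)
  qed
qed

lemma gen_act:
  fixes r :: "nat \<Rightarrow> 'a::comm_ring_1 mat"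
  assumes r: "\<And>i. i \<in> I \<Longrightarrow> r i \<in> carrier_mat n n" "\<And>i. i \<in> I \<Longrightarrow> r i * r i = 1\<^sub>m n"
    and g: "g \<in> gen ((\<lambda>i. act n (r i)) ` I)"
  shows "\<exists>M\<in>generate (GL_group n) (r ` I). act n M = g"
proof -
  interpret GL: group "GL_group n :: 'a mat monoid" by (rule group_GL)
  have c: "r ` I \<subseteq> carrier (GL_group n)" using r GL_involution by blast
  show ?thesis using g
  proof induction
    case gen_id
    show ?case using generate.one[of "GL_group n" "r ` I"]
      by (intro bexI[of _ "1\<^sub>m n"]) (simp_all only: act_one GL_simps)
  next
    case (gen_step s g)
    then obtain i M where i: "i \<in> I" "s = act n (r i)"
      and M: "M \<in> generate (GL_group n) (r ` I)" "act n M = g" by blast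
    have "M \<in> carrier_mat n n"
      using GL.generate_in_carrier[OF c M(1)] GL_carrier_mat by blast
    then have "act n (r i * M) = s \<circ> g" by (simp only: act_mult r(1)[OF i(1)] i(2) M(2))
    moreover have "r i * M \<in> generate (GL_group n) (r ` I)"
      using generate.eng[OF generate.incl M(1), of "r i"] i(1) by (simp add: GL_simps)
    ultimately show ?case by blast
  qed
qed

section \<open>Forms with a given Gram matrix\<close>

definition gram_form :: "nat \<Rightarrow> (nat \<Rightarrow> nat \<Rightarrow> 'a::comm_ring_1) \<Rightarrow> 'a poly \<Rightarrow> 'a poly \<Rightarrow> 'a" where
  "gram_form n C x y = (\<Sum>i<n. \<Sum>j<n. coeff x i * C i j * coeff y j)"

lemma gram_form_bvec_right:
  "gram_form n C x (bvec j) = (if j < n then \<Sum>i<n. coeff x i * C i j else 0)"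
proof -
  have "(\<Sum>l<n. coeff x i * C i l * coeff (bvec j) l) = (\<Sum>l<n. if l = j then coeff x i * C i l else 0)" for i
    by (intro sum.cong) auto
  then show ?thesis by (simp add: gram_form_def)
qed

lemma gram_form_bvec:
  "gram_form n C (bvec i) (bvec j) = (if i < n \<and> j < n then C i j else 0)"
proof -
  have "(\<Sum>l<n. coeff (bvec i) l * C l j) = (\<Sum>l<n. if l = i then C l j else 0)"
    by (intro sum.cong) auto
  then show ?thesis by (simp add: gram_form_bvec_right)
qed

lemma gram_form_bform:
  fixes C :: "nat \<Rightarrow> nat \<Rightarrow> 'a::field"
  assumes "\<And>i j. i < n \<Longrightarrow> j < n \<Longrightarrow> C i j = C j i" "(2::'a) \<noteq> 0"
  shows "bform (gram_form n C)"
proof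
  fix x y z :: "'a poly" and c :: 'a
  show "gram_form n C (x + y) z = gram_form n C x z + gram_form n C y z"
    by (simp add: gram_form_def algebra_simps sum.distrib)
  show "gram_form n C (c \<cdot> x) z = c * gram_form n C x z"
    by (simp add: gram_form_def sum_distrib_left mult.assoc)
  have "gram_form n C x y = (\<Sum>j<n. \<Sum>i<n. coeff x i * C i j * coeff y j)"
    unfolding gram_form_def by (rule sum.swap)
  also have "\<dots> = gram_form n C y x"
    unfolding gram_form_def using assms(1) by (intro sum.cong) (auto simp: algebra_simps)
  finally show "gram_form n C x y = gram_form n C y x" .
qed fact

theorem theorem3p2:
  fixes form :: "'v::euclidean_space \<Rightarrow> 'v \<Rightarrow> real"
    and b :: "nat \<Rightarrow> 'v"
    and k l n :: nat
  assumes "n = k + l + 1"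
    and "DIM('v) = n"
    and "bilinear form"
    and "\<And>x y. form x y = form y x"
    and "inj_on b {..<n}"
    and "independent (b ` {..<n})"
    and "span (b ` {..<n}) = UNIV"
    and "\<And>i. i < n \<Longrightarrow> form (b i) (b i) = 1"
    and "\<And>j. 1 \<le> j \<Longrightarrow> j \<le> k \<Longrightarrow> form (b (j - 1)) (b j) = - 1 / 2"
    and "\<And>j. k < j \<Longrightarrow> j \<le> n - 1 \<Longrightarrow> form (b (j - 1)) (b j) = - 1"
    and "\<And>i j. i < n \<Longrightarrow> j < n \<Longrightarrow> i + 2 \<le> j \<or> j + 2 \<le> i \<Longrightarrow> form (b i) (b j) = 0"
    and "CARD('p::prime_card) \<ge> 3"
  shows "string_C_group (reduced_group form b n :: 'p mod_ring mat monoid) n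
           (reduced_reflection form b n)"
proof -
  \<comment> \<open>Adjacent basis vectors may have product -1/2, so the doubled products are
    reduced and then halved in the field; \<open>C\<close> is the Gram matrix modulo p.\<close>
  define Z where "Z i j = \<lfloor>2 * form (b i) (b j)\<rfloor>" for i j
  define C :: "nat \<Rightarrow> nat \<Rightarrow> 'p mod_ring" where "C i j = of_int (Z i j) / 2" for i j
  define B where "B = gram_form n C"
  define r :: "nat \<Rightarrow> 'p mod_ring mat" where "r = reduced_reflection form b n"
  have two: "(2::'p mod_ring) \<noteq> 0"
  proof
    assume "(2::'p mod_ring) = 0"
    then have "CARD('p) dvd 2" using of_nat_0_mod_ring_dvd[of 2, where 'a = 'p] by simp
    then have "CARD('p) \<le> 2" by (rule dvd_imp_le) simp
    then show False using assms(12) by simp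
  qed
  have three: "CARD('p) = 3" if "(3::'p mod_ring) = 0"
  proof -
    have "CARD('p) dvd 3" using of_nat_0_mod_ring_dvd[of 3, where 'a = 'p] that by simp
    then have "CARD('p) \<le> 3" by (rule dvd_imp_le) simp
    then show ?thesis using assms(12) by simp
  qed
  have Zsym: "Z i j = Z j i" for i j by (simp add: Z_def assms(4)[of "b i"])
  have Zdiag: "Z i i = 2" if "i < n" for i using assms(8)[OF that] by (simp add: Z_def)
  have Zk: "Z i (i + 1) = -1" if "i + 1 \<le> k" for i
  proof -
    have "2 * form (b i) (b (i + 1)) = of_int (-1)" using assms(9)[of "i + 1"] that by simp
    then show ?thesis unfolding Z_def by (simp only: floor_of_int)
  qed
  have Zl: "Z i (i + 1) = -2" if "k < i + 1" "i + 1 < n" for i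
  proof -
    have "2 * form (b i) (b (i + 1)) = of_int (-2)" using assms(10)[of "i + 1"] that by simp
    then show ?thesis unfolding Z_def by (simp only: floor_of_int)
  qed
  have Zfar: "Z i j = 0" if "i < n" "j < n" "i + 2 \<le> j \<or> j + 2 \<le> i" for i j
    using assms(11)[OF that] by (simp add: Z_def)
  have Z: "2 * form (b i) (b j) = of_int (Z i j)" if ij: "i < n" "j < n" for i j
  proof -
    have adj: "2 * form (b i) (b (i + 1)) \<in> \<int>" if "i + 1 < n" for i
      using assms(9)[of "i + 1"] assms(10)[of "i + 1"] that by (cases "i + 1 \<le> k") auto
    consider "i = j" | "j = i + 1" | "i = j + 1" | "i + 2 \<le> j \<or> j + 2 \<le> i" by linarith
    then have "2 * form (b i) (b j) \<in> \<int>"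
    proof cases
      case 1 then show ?thesis using assms(8) ij by simp
    next
      case 2 then show ?thesis using adj ij by simp
    next
      case 3 then show ?thesis using adj[of j] ij by (simp add: assms(4)[of "b (Suc j)" "b j"])
    next
      case 4 then show ?thesis using assms(11)[OF ij] by simp
    qed
    then show ?thesis by (auto simp: Z_def elim: Ints_cases)
  qed
  interpret bform B unfolding B_def
  proof (rule gram_form_bform[OF _ two])
    show "C i j = C j i" for i j by (simp only: C_def Zsym[of i j])
  qed
  have Bb: "B (bvec i) (bvec j) = (if i < n \<and> j < n then C i j else 0)" for i j
    by (simp add: B_def gram_form_bvec)
  interpret string_form B n
  proof unfold_locales
    show "finite (UNIV :: 'p mod_ring set)" by simp
    show "\<exists>m::nat. x = of_nat m" for x :: "'p mod_ring" using surj_of_nat_mod_ring by blast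
    fix i j :: nat
    show "i < n \<Longrightarrow> B (bvec i) (bvec i) = 1" using two by (simp add: Bb C_def Zdiag)
    have Ck: "C i (i + 1) = - 1 / 2" if "i + 1 \<le> k" for i unfolding C_def Zk[OF that] by simp
    have Cl: "C i (i + 1) = - 1" if "k < i + 1" "i + 1 < n" for i
      unfolding C_def Zl[OF that] using two by simp
    show "B (bvec i) (bvec (i + 1)) \<noteq> 0" if "i + 1 < n"
      using Ck[of i] Cl[of i] that two by (cases "i + 1 \<le> k") (simp_all add: Bb)
    show "i + 2 \<le> j \<Longrightarrow> B (bvec i) (bvec j) = 0" by (simp add: Bb C_def Zfar)
    show "n \<le> j \<Longrightarrow> B x (bvec j) = 0" for x by (simp add: B_def gram_form_bvec_right)
    show "(\<forall>j\<le>i. (2 * B (bvec j) (bvec (j + 1)))\<^sup>2 = 1) \<or>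
        ((3::'p mod_ring) \<noteq> 0 \<and> B (bvec i) (bvec (i + 1)) = - 1)" if i: "i + 1 < n"
    \<comment> \<open>Modulo 3 the product -1 also counts as a period 3, since (-2)^2 = 4 =
      1.\<close>
    proof (cases "i + 1 \<le> k \<or> (3::'p mod_ring) = 0")
      case True
      have "(2 * B (bvec j) (bvec (j + 1)))\<^sup>2 = 1" if "j \<le> i" for j
      proof (cases "j + 1 \<le> k")
        case True
        then show ?thesis using Ck[of j] that i two by (simp add: Bb)
      next
        case False
        then have z: "(3::'p mod_ring) = 0" using True that by simp
        have "(4::'p mod_ring) = 3 + 1" by simp
        then have "(4::'p mod_ring) = 1" unfolding z by simp
        then show ?thesis using False Cl[of j] that i by (simp add: Bb power2_eq_square)
      qed
      then show ?thesis by blast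
    next
      case False
      then show ?thesis using Cl[of i] i by (simp add: Bb)
    qed
  qed
  have rc: "r i \<in> carrier_mat n n" for i
    by (simp add: r_def reduced_reflection_def reduce_mat_def reflection_mat_def)
  have rij: "r i $$ (m, j) = (if m = j then 1 else 0) - (if m = i then of_int (Z j i) else 0)"
    if "i < n" "m < n" "j < n" for i j m
  proof -
    have "reflection_mat form b n i $$ (m, j) =
        of_int ((if m = j then 1 else 0) - (if m = i then Z j i else 0))"
      using reflection_mat_entry[OF assms(5,6) that(1,3,2), of form] Z that by simp
    moreover have "r i $$ (m, j) = of_int \<lfloor>reflection_mat form b n i $$ (m, j)\<rfloor>"
      using that by (simp add: r_def reduced_reflection_def reduce_mat_def reflection_mat_def)
    ultimately have "r i $$ (m, j) = of_int ((if m = j then 1 else 0) - (if m = i then Z j i else 0))"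
      by (simp only: floor_of_int)
    then show ?thesis by simp
  qed
  \<comment> \<open>Only row \<open>i\<close> of \<open>r i\<close> differs from the identity
    matrix, by the entries \<open>2 * C j i\<close>; on coefficients this is the mirror for the
    reduced form.\<close>
  have ract: "act n (r i) = mirror (bvec i)" if i: "i < n" for i
  proof (intro ext poly_eqI)
    fix x m
    have "B (bvec i) (bvec i) = 1" using unit[OF i] .
    then have "coeff (mirror (bvec i) x) m = coeff x m - (if i = m then 2 * B x (bvec i) else 0)"
      by (simp add: mirror_def coeff_monom)
    also have "2 * B x (bvec i) = (\<Sum>j<n. of_int (Z j i) * coeff x j)"
      using i two by (simp add: B_def gram_form_bvec_right sum_distrib_left C_def mult.commute)
    also have "coeff x m - (if i = m then \<Sum>j<n. of_int (Z j i) * coeff x j else 0) = coeff (act n (r i) x) m"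
    proof (cases "m < n")
      case True
      have "(\<Sum>j<n. r i $$ (m, j) * coeff x j) =
          (\<Sum>j<n. (if j = m then coeff x j else 0) - (if i = m then of_int (Z j i) * coeff x j else 0))"
        using i True by (intro sum.cong) (auto simp: rij algebra_simps)
      then show ?thesis using True by (auto simp: coeff_act sum_subtractf)
    next
      case False
      then show ?thesis using i by (simp add: coeff_act)
    qed
    finally show "coeff (act n (r i) x) m = coeff (mirror (bvec i) x) m" by simp
  qed
  have act_eqI: "M = N" if "act n M = act n N" "M \<in> carrier_mat n n" "N \<in> carrier_mat n n"
    for M N :: "'p mod_ring mat" using act_inj that by blast
  have rr: "r i * r i = 1\<^sub>m n" if "i < n" for i
    by (rule act_eqI[OF _ mult_carrier_mat[OF rc rc] one_carrier_mat])
      (simp only: act_mult[OF rc rc] act_one ract[OF that] mirror_invol)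
  let ?GL = "GL_group n :: 'p mod_ring mat monoid"
  let ?G = "reduced_group form b n :: 'p mod_ring mat monoid"
  interpret GL: group ?GL by (rule group_GL)
  define H where "H = generate ?GL (r ` {..<n})"
  have G: "?G = ?GL\<lparr>carrier := H\<rparr>" by (simp add: reduced_group_def H_def r_def)
  have rGL: "r ` {..<n} \<subseteq> carrier ?GL" using rc rr GL_involution by blast
  have H: "subgroup H ?GL" unfolding H_def by (rule GL.generate_is_subgroup[OF rGL])
  have rH: "r ` {..<n} \<subseteq> H" unfolding H_def by (auto intro: generate.incl)
  have genG: "generate ?G (r ` I) = generate ?GL (r ` I)" if "I \<subseteq> {..<n}" for I
    unfolding G using rH that by (intro GL.generate_consistent[OF _ H]) auto
  have actI: "(\<lambda>i. act n (r i)) ` I = R ` I" if "I \<subseteq> {..<n}" for I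
    using that ract by (intro image_cong) auto
  have inter: "generate ?GL (r ` I) \<inter> generate ?GL (r ` J) = generate ?GL (r ` (I \<inter> J))"
    if IJ: "I \<subseteq> {..<n}" "J \<subseteq> {..<n}" for I J
  proof
    show "generate ?GL (r ` (I \<inter> J)) \<subseteq> generate ?GL (r ` I) \<inter> generate ?GL (r ` J)"
      by (intro Int_greatest GL.mono_generate) auto
    show "generate ?GL (r ` I) \<inter> generate ?GL (r ` J) \<subseteq> generate ?GL (r ` (I \<inter> J))"
    proof
      fix M assume M: "M \<in> generate ?GL (r ` I) \<inter> generate ?GL (r ` J)"
      have a: "act n M \<in> G A" if "A \<subseteq> {..<n}" "M \<in> generate ?GL (r ` A)" for A
        using act_generate[of A r n M] rc rr that unfolding actI[OF that(1)] by blast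
      \<comment> \<open>The intersection is computed among products of mirrors and pulled back to
        matrices, on which \<open>act n\<close> is injective.\<close>
      have "act n M \<in> G (I \<inter> J)"
        by (rule parabolic_intersection[OF IJ]) (use a IJ M in blast)+
      moreover have IJ': "I \<inter> J \<subseteq> {..<n}" using IJ by blast
      ultimately have "act n M \<in> gen ((\<lambda>i. act n (r i)) ` (I \<inter> J))" by (simp only: actI)
      moreover have "r i * r i = 1\<^sub>m n" if "i \<in> I \<inter> J" for i using rr IJ' that by blast
      ultimately obtain N where N: "N \<in> generate ?GL (r ` (I \<inter> J))" "act n N = act n M"
        using gen_act[of "I \<inter> J" r n "act n M", OF rc] by blast
      have c: "P \<in> carrier_mat n n" if "P \<in> generate ?GL (r ` A)" "A \<subseteq> {..<n}" for P A
        using GL.generate_in_carrier[OF _ that(1)] that(2) rGL GL_carrier_mat by blast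
      have "N = M" by (rule act_eqI[OF N(2) c[OF N(1) IJ'] c[OF IntD1[OF M] IJ(1)]])
      then show "M \<in> generate ?GL (r ` (I \<inter> J))" using N by simp
    qed
  qed
  have "string_C_group ?G n r"
    unfolding string_C_group_def
  proof (intro conjI allI impI)
    show "group ?G" unfolding G by (rule GL.subgroup_imp_group[OF H])
    show "r ` {..<n} \<subseteq> carrier ?G" using rH by (simp add: G)
    show "generate ?G (r ` {..<n}) = carrier ?G" using genG[of "{..<n}"] by (simp add: G H_def)
    fix i assume i: "i < n"
    show "r i \<noteq> \<one>\<^bsub>?G\<^esub>"
    proof
      assume "r i = \<one>\<^bsub>?G\<^esub>"
      then have "mirror (bvec i) = id" using ract[OF i] by (simp add: G GL_simps act_one)
      then have "- bvec i = (bvec i :: 'p mod_ring poly)" using mirror_self[of "bvec i"] unit[OF i] by simp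
      then have "- coeff (bvec i :: 'p mod_ring poly) i = coeff (bvec i) i" by (metis coeff_minus)
      then have "(1::'p mod_ring) + 1 = 0" by (simp add: neg_eq_iff_add_eq_0)
      then show False using two by simp
    qed
    show "r i \<otimes>\<^bsub>?G\<^esub> r i = \<one>\<^bsub>?G\<^esub>" using rr[OF i] by (simp add: G GL_simps)
    fix j assume j: "j < n" "i + 2 \<le> j"
    have "r i * r j = r j * r i"
      by (rule act_eqI[OF _ mult_carrier_mat[OF rc rc] mult_carrier_mat[OF rc rc]])
        (simp only: act_mult[OF rc rc] ract[OF i] ract[OF j(1)] mirror_commute[OF far[OF j(2)]])
    then show "r i \<otimes>\<^bsub>?G\<^esub> r j = r j \<otimes>\<^bsub>?G\<^esub> r i" by (simp add: G GL_simps)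
  next
    fix I J assume "I \<subseteq> {..<n}" "J \<subseteq> {..<n}"
    then show "generate ?G (r ` I) \<inter> generate ?G (r ` J) = generate ?G (r ` (I \<inter> J))"
      using inter[of I J] genG[of I] genG[of J] genG[of "I \<inter> J"] by (simp add: le_infI1)
  qed
  then show ?thesis by (simp add: r_def)
qed

end
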